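(* For every oriented matroid $\mathsf M$ on a ground set $E$ and every $e\in E$, there is a homotopy equivalence $|\mathcal S|\simeq S^1\times|d\mathcal S|$, where $\mathcal S$ is the Salvetti poset of $\mathsf M$ and $d\mathcal S$ its deconed Salvetti poset with respect to $e$.
   Context: Covectors $\mathcal F\subseteq\{+,0,-\}^E$ of $\mathsf M$ are ordered componentwise with $0<+$, $0<-$; topes $\mathcal T$ are the maximal covectors. Composition: $(X\circ Y)_f=Y_f$ if $X_f=0$, else $X_f$. The Salvetti poset is $\mathcal S=\{(F,C)\in\mathcal F\times\mathcal T: F\circ C=C\}$ with $(F,C)\le(F',C')$ iff $F\ge F'$ and $F\circ C'=C$. Let $d\mathcal F=\{F\in\mathcal F: F_e=+\}$ and $d\mathcal S=\{(F,C)\in\mathcal S: F,C\in d\mathcal F\}$ with the induced order. $|\mathcal P|$ denotes the geometric realization of the order complex of a poset $\mathcal P$.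
   Formalization: The formal theorem assumes in addition that e is not a loop (some covector is nonzero at e); if e is a loop, dS is empty, so S¹×|dS| is empty while |S| is not, and the claim fails. *)

theory Defs
  imports "HOL-Analysis.Analysis"
begin

text \<open>Signs and sign vectors. A sign vector on ground set E is a function
  'e => sign which is Zero outside E.\<close>

datatype sign = Neg | Zero | Pos

definition sign_neg :: "sign \<Rightarrow> sign" where
  "sign_neg s = (case s of Pos \<Rightarrow> Neg | Neg \<Rightarrow> Pos | Zero \<Rightarrow> Zero)"

definition sv_neg :: "('e \<Rightarrow> sign) \<Rightarrow> ('e \<Rightarrow> sign)" where
  "sv_neg X = (\<lambda>f. sign_neg (X f))"

definition sv_le :: "('e \<Rightarrow> sign) \<Rightarrow> ('e \<Rightarrow> sign) \<Rightarrow> bool" where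
  "sv_le X Y \<longleftrightarrow> (\<forall>f. X f = Zero \<or> X f = Y f)"

definition sv_comp :: "('e \<Rightarrow> sign) \<Rightarrow> ('e \<Rightarrow> sign) \<Rightarrow> ('e \<Rightarrow> sign)" where
  "sv_comp X Y = (\<lambda>f. if X f = Zero then Y f else X f)"

definition sv_sep :: "('e \<Rightarrow> sign) \<Rightarrow> ('e \<Rightarrow> sign) \<Rightarrow> 'e set" where
  "sv_sep X Y = {f. X f \<noteq> Zero \<and> Y f = sign_neg (X f)}"

text \<open>Covector axioms of an oriented matroid on the finite ground set E.\<close>
definition oriented_matroid :: "'e set \<Rightarrow> ('e \<Rightarrow> sign) set \<Rightarrow> bool" where
  "oriented_matroid E F \<longleftrightarrow>
     finite E \<and>
     (\<forall>X\<in>F. \<forall>f. f \<notin> E \<longrightarrow> X f = Zero) \<and>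
     (\<lambda>_. Zero) \<in> F \<and>
     (\<forall>X\<in>F. sv_neg X \<in> F) \<and>
     (\<forall>X\<in>F. \<forall>Y\<in>F. sv_comp X Y \<in> F) \<and>
     (\<forall>X\<in>F. \<forall>Y\<in>F. \<forall>f\<in>sv_sep X Y. \<exists>Z\<in>F. Z f = Zero \<and>
         (\<forall>g. g \<notin> sv_sep X Y \<longrightarrow> Z g = sv_comp X Y g))"

definition topes :: "('e \<Rightarrow> sign) set \<Rightarrow> ('e \<Rightarrow> sign) set" where
  "topes F = {T \<in> F. \<forall>X\<in>F. sv_le T X \<longrightarrow> X = T}"

definition salvetti :: "('e \<Rightarrow> sign) set \<Rightarrow> (('e \<Rightarrow> sign) \<times> ('e \<Rightarrow> sign)) set" where
  "salvetti F = {(X, C). X \<in> F \<and> C \<in> topes F \<and> sv_comp X C = C}"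

definition salvetti_le ::
  "(('e \<Rightarrow> sign) \<times> ('e \<Rightarrow> sign)) \<Rightarrow> (('e \<Rightarrow> sign) \<times> ('e \<Rightarrow> sign)) \<Rightarrow> bool" where
  "salvetti_le p q \<longleftrightarrow> sv_le (fst q) (fst p) \<and> sv_comp (fst p) (snd q) = snd p"

definition decone :: "('e \<Rightarrow> sign) set \<Rightarrow> 'e \<Rightarrow> ('e \<Rightarrow> sign) set" where
  "decone F e = {X \<in> F. X e = Pos}"

definition deconed_salvetti ::
  "('e \<Rightarrow> sign) set \<Rightarrow> 'e \<Rightarrow> (('e \<Rightarrow> sign) \<times> ('e \<Rightarrow> sign)) set" where
  "deconed_salvetti F e = {(X, C) \<in> salvetti F. X \<in> decone F e \<and> C \<in> decone F e}"

text \<open>Geometric realization of the order complex of a finite poset (P, le):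
  points are barycentric coordinate functions on P (nonnegative, summing to 1)
  whose support is a chain, with the subspace topology of R^P.\<close>
definition order_realization :: "'a set \<Rightarrow> ('a \<Rightarrow> 'a \<Rightarrow> bool) \<Rightarrow> ('a \<Rightarrow> real) topology" where
  "order_realization P le =
     subtopology (powertop_real P)
       {u \<in> topspace (powertop_real P).
          (\<forall>x\<in>P. 0 \<le> u x) \<and> sum u P = 1 \<and>
          (\<forall>x\<in>P. \<forall>y\<in>P. u x \<noteq> 0 \<and> u y \<noteq> 0 \<longrightarrow> le x y \<or> le y x)}"

definition circle :: "complex topology" where
  "circle = top_of_set (sphere 0 1)"

end

(*
  A stratum of the complement of the complexified arrangement is a pair z = (X, Y) of covectors,
  the signs of the imaginary and of the real part, without a common zero.  By Quillen's fibre lemma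
  the poset of strata maps by a homotopy equivalence to the Salvetti poset, (X, Y) to (Y, Y o X),
  and the strata with X e = 0, Y e = + likewise map to the deconed Salvetti poset.  All fibres
  reduce to families of covectors with prescribed signs on a subset, and these are contractible by
  induction on the number of undetermined elements.

  It remains to split off the circle.  In the realizable case this is z = z(e) w with w(e) = 1.
  Signs determine such a product only up to a neighbouring cell, so the product map is replaced by
  the poset of all pairs (z, w) compatible with z = z(e) w.  Both projections, to z and to
  (z(e), w), have contractible fibres; the values z(e) form the face poset of an octagon.
*)
theory Submission
  imports Defs
begin

text \<open>The Salvetti poset remembers the imaginary part only up to composition with the real
  part, so multiplication by \<open>i\<close> cannot be seen on it. Strata treat both parts alike,
  and the four axial units act on them exactly. A direction in an open quadrant forces an addition
  of two covectors, whose signs are determined only where the summands do not oppose each other;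
  signs alone do not single out a covector there. A relation between \<open>z\<close> and
  \<open>w\<close> avoids this choice.

  What makes the relation usable is composition. A pair lying below an open direction never
  conflicts in sign with the coarse product, so composing it with any covectors above that product
  moves it up into the family of all such covectors, and that family is given by prescribed signs.
  Keeping \<open>w\<close> normalised at \<open>e\<close> costs one elimination: the two summands of
  the imaginary part of \<open>conj(z(e)) z\<close> oppose each other at \<open>e\<close>.

  On the topological side everything rests on one move, the removal of a point whose link is
  contractible.\<close>

section \<open>Order complexes\<close>

text \<open>As an introduction rule this fact makes proofs about evaluation maps loop.\<close>

declare continuous_on_coordinatewise_then_product [continuous_intros del]

text \<open>In \<open>order_realization\<close> a point has the value \<open>undefined\<close> off
  \<open>P\<close>. Weights that vanish there put the complexes of all subposets into one function
  space, where a finite subposet gives a subset.\<close>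

definition order_complex :: "('a \<Rightarrow> 'a \<Rightarrow> bool) \<Rightarrow> 'a set \<Rightarrow> ('a \<Rightarrow> real) set" where
  "order_complex le P = {u. (\<forall>x. 0 \<le> u x) \<and> (\<forall>x. x \<notin> P \<longrightarrow> u x = 0) \<and> sum u P = 1 \<and>
     (\<forall>x y. u x \<noteq> 0 \<longrightarrow> u y \<noteq> 0 \<longrightarrow> le x y \<or> le y x)}"

lemma order_complexD:
  assumes "u \<in> order_complex le P"
  shows "0 \<le> u x" "x \<notin> P \<Longrightarrow> u x = 0" "sum u P = 1" "u x \<noteq> 0 \<Longrightarrow> u y \<noteq> 0 \<Longrightarrow> le x y \<or> le y x"
  using assms by (auto simp: order_complex_def)

lemma order_complex_le1:
  assumes "u \<in> order_complex le P" "finite P"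
  shows "u x \<le> 1"
proof (cases "x \<in> P")
  case True
  then have "u x \<le> sum u P"
    using assms by (intro member_le_sum) (auto simp: order_complex_def)
  then show ?thesis using order_complexD(3)[OF assms(1)] by simp
qed (use order_complexD[OF assms(1)] in auto)

lemma order_complex_mono:
  assumes "A \<subseteq> P" "finite P"
  shows "order_complex le A = {u \<in> order_complex le P. \<forall>x. x \<notin> A \<longrightarrow> u x = 0}"
proof -
  have "sum u A = sum u P" if "\<forall>x. x \<notin> A \<longrightarrow> u x = 0" for u :: "'a \<Rightarrow> real"
    using assms that by (intro sum.mono_neutral_left) auto
  then show ?thesis using assms by (auto simp: order_complex_def)
qed

lemma order_complex_subset: "A \<subseteq> P \<Longrightarrow> finite P \<Longrightarrow> order_complex le A \<subseteq> order_complex le P"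
  using order_complex_mono by blast

lemma continuous_on_coord:
  fixes f :: "'b::topological_space \<Rightarrow> 'a \<Rightarrow> real"
  shows "continuous_on S f \<Longrightarrow> continuous_on S (\<lambda>z. f z y)"
  by (rule continuous_on_product_then_coordinatewise)

text \<open>At each \<open>z\<close> the two supports together form a chain, so the whole segment
  from \<open>f z\<close> to \<open>g z\<close> lies in one simplex.\<close>

lemma straight_line_homotopic:
  fixes f g :: "'b::topological_space \<Rightarrow> 'a \<Rightarrow> real"
  assumes f: "continuous_on Z f" "f \<in> Z \<rightarrow> order_complex le P" and g: "continuous_on Z g" "g \<in> Z \<rightarrow> order_complex le P"
    and c: "\<And>z a b. z \<in> Z \<Longrightarrow> f z a \<noteq> 0 \<Longrightarrow> g z b \<noteq> 0 \<Longrightarrow> le a b \<or> le b a"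
  shows "homotopic_with_canon (\<lambda>_. True) Z (order_complex le P) f g"
proof -
  define h where "h = (\<lambda>(s::real, z) y. (1 - s) * f z y + s * g z y)"
  have "continuous_on ({0..1} \<times> Z) h"
  proof (rule continuous_on_coordinatewise_then_product)
    fix y
    have *: "continuous_on ({0..1::real} \<times> Z) (\<lambda>p. f (snd p) y)"
      "continuous_on ({0..1::real} \<times> Z) (\<lambda>p. g (snd p) y)"
      by (auto intro!: continuous_on_compose2[OF continuous_on_coord[OF f(1)]]
          continuous_on_compose2[OF continuous_on_coord[OF g(1)]] continuous_on_snd continuous_on_id)
    show "continuous_on ({0..1} \<times> Z) (\<lambda>p. h p y)"
      unfolding h_def case_prod_unfold by (intro continuous_intros *)
  qed
  moreover have "h (s, z) \<in> order_complex le P" if s: "s \<in> {0..1}" and z: "z \<in> Z" for s z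
  proof -
    have fz: "f z \<in> order_complex le P" and gz: "g z \<in> order_complex le P" using f g z by auto
    have "sum (h (s, z)) P = 1"
      by (simp add: h_def sum.distrib flip: sum_distrib_left) (simp add: order_complexD(3)[OF fz] order_complexD(3)[OF gz])
    moreover have "0 \<le> h (s, z) y" for y
      using s order_complexD(1)[OF fz] order_complexD(1)[OF gz] by (simp add: h_def)
    moreover have "y \<notin> P \<Longrightarrow> h (s, z) y = 0" for y
      using order_complexD(2)[OF fz] order_complexD(2)[OF gz] by (simp add: h_def)
    moreover have "le a b \<or> le b a" if "h (s, z) a \<noteq> 0" "h (s, z) b \<noteq> 0" for a b
    proof -
      have "f z a \<noteq> 0 \<or> g z a \<noteq> 0" "f z b \<noteq> 0 \<or> g z b \<noteq> 0" using that by (auto simp: h_def)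
      then show ?thesis using order_complexD(4)[OF fz] order_complexD(4)[OF gz] c[OF z] by blast
    qed
    ultimately show ?thesis by (simp add: order_complex_def)
  qed
  ultimately show ?thesis
    by (subst homotopic_with, simp)
       (intro exI[of _ h], auto simp: h_def Pi_iff)
qed

text \<open>Every chain can be extended by \<open>x\<close>, so each point is joined to the vertex
  \<open>x\<close> by a segment.\<close>

lemma contractible_order_complex_cone:
  assumes "finite P" "x \<in> P" "\<And>y. y \<in> P \<Longrightarrow> le x y \<or> le y x"
  shows "contractible (order_complex le P)"
proof -
  define d where "d = (\<lambda>y. if y = x then 1 else 0 :: real)"
  have "homotopic_with_canon (\<lambda>_. True) (order_complex le P) (order_complex le P) id (\<lambda>_. d)"
  proof (rule straight_line_homotopic)
    show "(\<lambda>_. d) \<in> order_complex le P \<rightarrow> order_complex le P"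
      using assms(1,2) assms(3)[OF assms(2)] by (auto simp: order_complex_def d_def split: if_splits)
    fix z a b assume "z \<in> order_complex le P" "id z a \<noteq> 0" "d b \<noteq> 0"
    then show "le a b \<or> le b a"
      using assms(3)[of a] by (auto simp: d_def order_complex_def split: if_splits)
  qed (auto simp: id_def)
  then show ?thesis unfolding contractible_def by blast
qed

text \<open>The cone over a contractible link is pushed into the link in three stages: stretch a
  neighbourhood of the base onto the whole cone (to G 0), contract the base direction near the apex
  (from G 0 to G 1), and then drop the coordinate of the apex (to r).\<close>

lemma order_complex_remove_point:
  fixes le :: "'a \<Rightarrow> 'a \<Rightarrow> bool"
  assumes fin: "finite P" and x: "x \<notin> P" and refl: "\<And>y. y \<in> insert x P \<Longrightarrow> le y y"
    and L: "L = {y \<in> P. le x y \<or> le y x}"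
    and Lne: "L \<noteq> {}" and con: "contractible (order_complex le L)"
  shows "order_complex le P homotopy_eqv order_complex le (insert x P)"
proof -
  define X where "X = order_complex le (insert x P)"
  define star where "star = {u::'a\<Rightarrow>real. \<forall>y\<in>P - L. u y = 0}"
  define cone where "cone = (\<lambda>t (v::'a\<Rightarrow>real) y. if y = x then t else (1 - t) * v y)"
  \<comment> \<open>Projection from the apex \<open>x\<close> to the base, normalised to total
    weight 1. For \<open>u x \<le> 1/2\<close> the denominator is \<open>1 - u x\<close>; the
    maximum only keeps it away from 0, so that \<open>nv\<close> is continuous everywhere.\<close>
  define nv where "nv = (\<lambda>(u::'a\<Rightarrow>real) y. if y = x then 0 else u y / max (1/2) (1 - u x))"
  have LP: "L \<subseteq> P" and xL: "x \<notin> L" using L x by auto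
  have nL: "v y = 0" if "v \<in> order_complex le L" "y \<notin> P" for v y using order_complexD(2)[OF that(1)] that(2) LP by auto
  have finL: "finite L" using LP fin finite_subset by auto
  obtain l where l: "l \<in> L" using Lne by auto
  obtain a where a: "homotopic_with_canon (\<lambda>_. True) (order_complex le L) (order_complex le L) id (\<lambda>_. a)"
    using con unfolding contractible_def by blast
  then obtain h where hc: "continuous_on ({0..1::real} \<times> order_complex le L) h"
    and hm: "h \<in> {0..1} \<times> order_complex le L \<rightarrow> order_complex le L"
    and h0: "\<And>v. v \<in> order_complex le L \<Longrightarrow> h (0, v) = v" and h1: "\<And>v. v \<in> order_complex le L \<Longrightarrow> h (1, v) = a"
    by (subst (asm) homotopic_with) (simp, auto simp: image_subset_iff_funcset)
  have PX: "order_complex le P = {u \<in> X. u x = 0}"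
    unfolding X_def using fin x by (subst order_complex_mono[of P "insert x P"]) (auto simp: order_complex_def)
  have LX: "order_complex le L \<subseteq> order_complex le P" using LP fin by (rule order_complex_subset)
  have coneX: "cone t v \<in> X" if "0 \<le> t" "t \<le> 1" "t < 1 \<Longrightarrow> v \<in> order_complex le L" for t v
  proof (cases "t < 1")
    case True
    then have v: "v \<in> order_complex le L" using that by auto
    have "sum (cone t v) P = (1 - t) * sum v P"
      unfolding sum_distrib_left using x by (intro sum.cong) (auto simp: cone_def)
    moreover have "sum v P = 1" using v LX order_complexD(3) by blast
    moreover have "le b c \<or> le c b" if "cone t v b \<noteq> 0" "cone t v c \<noteq> 0" for b c
    proof -
      have "b = x \<or> v b \<noteq> 0" "c = x \<or> v c \<noteq> 0" using that by (auto simp: cone_def split: if_splits)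
      moreover have "v y \<noteq> 0 \<Longrightarrow> le x y \<or> le y x" for y using order_complexD(2)[OF v] L by auto
      ultimately show ?thesis using order_complexD(4)[OF v] refl by blast
    qed
    ultimately show ?thesis
      unfolding X_def order_complex_def using that(1,2) x fin order_complexD(1)[OF v] nL[OF v]
      by (auto simp: cone_def)
  next
    case False
    then have "t = 1" using that by auto
    moreover have "sum (cone 1 v) P = 0" using x by (intro sum.neutral) (auto simp: cone_def)
    ultimately show ?thesis unfolding X_def order_complex_def using fin x refl by (auto simp: cone_def split: if_splits)
  qed
  have starX: "u \<in> star" if "u \<in> X" "u x \<noteq> 0" for u
    using that order_complexD(4)[OF that(1)[unfolded X_def] that(2)] L by (auto simp: star_def)
  have nvL: "nv u \<in> order_complex le L" if u: "u \<in> X" "u \<in> star" "u x \<le> 1/2" for u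
  proof -
    note u' = u(1)[unfolded X_def]
    have m: "max (1/2) (1 - u x) = 1 - u x" using u by auto
    have "u x + sum u P = 1" using order_complexD(3)[OF u'] fin x by simp
    moreover have "sum u P = sum u L" using u(2) LP fin by (intro sum.mono_neutral_right) (auto simp: star_def)
    moreover have "sum (nv u) L = sum u L / (1 - u x)"
      unfolding sum_divide_distrib using xL by (intro sum.cong) (auto simp: nv_def m)
    ultimately have "sum u L = 1 - u x" "sum (nv u) L = sum u L / (1 - u x)" by linarith+
    then have "sum (nv u) L = 1" using u by simp
    then show ?thesis
      using u(2,3) order_complexD[OF u'] by (auto simp: order_complex_def nv_def m star_def)
  qed
  have nv0: "nv u = u" if "u x = 0" for u using that by (auto simp: nv_def fun_eq_iff)
  have X01: "0 \<le> u x" "u x \<le> 1" if "u \<in> X" for u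
    using order_complexD(1)[of u le "insert x P" x] order_complex_le1[of u le "insert x P" x] fin that unfolding X_def by auto
  have ccoord: "continuous_on S (\<lambda>u::'a \<Rightarrow> real. u y)" for S and y :: 'a
    by (rule continuous_on_coord[OF continuous_on_id])
  have nvc: "continuous_on S nv" for S
  proof (rule continuous_on_coordinatewise_then_product)
    fix y show "continuous_on S (\<lambda>u. nv u y)"
      unfolding nv_def by (cases "y = x") (auto intro!: continuous_intros ccoord)
  qed
  have m01: "s * min 1 (4 * u x) \<in> {0..1}" if "u \<in> X" "s \<in> {0..1}" for u and s :: real
    using that X01[OF that(1)] mult_mono[of s 1 "min 1 (4 * u x)" 1] by auto
  define Z where "Z = {0..1::real} \<times> X"
  have aL: "a \<in> order_complex le L"
  proof -
    define d where "d = (\<lambda>y. if y = l then 1 else 0 :: real)"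
    have "d \<in> order_complex le L"
      using l finL refl[of l] LP by (auto simp: order_complex_def d_def)
    then show ?thesis using h1[of d] hm by force
  qed
  have csnd: "continuous_on S (\<lambda>p. snd p y)" for S :: "(real \<times> ('a \<Rightarrow> real)) set" and y
    by (rule continuous_on_coord[OF continuous_on_snd[OF continuous_on_id]])
  \<comment> \<open>The set where \<open>u x > 0\<close> is not closed, so the base is pasted to the
    closed condition \<open>star\<close> instead. The two overlap where \<open>u x = 0\<close>
    inside \<open>star\<close>, and only there must \<open>A\<close> and \<open>B\<close>
    agree.\<close>
  have paste: "continuous_on Z (\<lambda>p. if snd p x = 0 then A p else if snd p x \<le> 1/2 then B p else C p)"
    if A: "continuous_on {p \<in> Z. snd p x = 0} A"
      and B: "continuous_on {p \<in> Z. snd p \<in> star \<and> snd p x \<le> 1/2} B"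
      and C: "continuous_on {p \<in> Z. 1/2 \<le> snd p x} C"
      and AB: "\<And>p. p \<in> Z \<Longrightarrow> snd p \<in> star \<Longrightarrow> snd p x = 0 \<Longrightarrow> A p = B p"
      and BC: "\<And>p. p \<in> Z \<Longrightarrow> snd p \<in> star \<Longrightarrow> snd p x = 1/2 \<Longrightarrow> B p = C p"
    for A B C :: "real \<times> ('a \<Rightarrow> real) \<Rightarrow> ('a \<Rightarrow> real)"
  proof -
    define S T T1 T2 where "S = {p \<in> Z. snd p x = 0}" and "T = {p \<in> Z. snd p \<in> star}"
      and "T1 = {p \<in> Z. snd p \<in> star \<and> snd p x \<le> 1/2}" and "T2 = {p \<in> Z. 1/2 \<le> snd p x}"
    note defs = S_def T_def T1_def T2_def
    have T2': "T2 = {p \<in> Z. snd p \<in> star \<and> 1/2 \<le> snd p x}"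
      using starX by (auto simp: T2_def Z_def)
    have "snd p \<in> star \<or> snd p x = 0" if "p \<in> Z" for p
      using starX[of "snd p"] that by (auto simp: Z_def)
    then have ST: "Z = S \<union> T" by (auto simp: S_def T_def)
    have TT: "T = T1 \<union> T2" unfolding T2' by (auto simp: defs)
    have clS: "closedin (top_of_set (S \<union> T)) S" unfolding ST[symmetric]
      by (auto simp: closedin_closed S_def intro!: exI[of _ "{p. snd p x = 0}"] closed_Collect_eq csnd continuous_intros)
    have clT: "closedin (top_of_set (S \<union> T)) T" unfolding ST[symmetric]
    proof -
      have "closed (\<Inter>y\<in>P-L. {p :: real \<times> ('a \<Rightarrow> real). snd p y = 0})"
        by (intro closed_INT ballI closed_Collect_eq csnd continuous_intros)
      moreover have "T = Z \<inter> (\<Inter>y\<in>P-L. {p. snd p y = 0})" by (auto simp: T_def star_def)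
      ultimately show "closedin (top_of_set Z) T" by (auto simp: closedin_closed)
    qed
    have "closedin (top_of_set T) T1"
      by (auto simp: closedin_closed T_def T1_def intro!: exI[of _ "{p. snd p x \<le> 1/2}"] closed_Collect_le csnd continuous_intros)
    then have clT1: "closedin (top_of_set (T1 \<union> T2)) T1" by (simp add: TT)
    have "closedin (top_of_set T) T2" unfolding T2' 
      by (auto simp: closedin_closed T_def intro!: exI[of _ "{p. 1/2 \<le> snd p x}"] closed_Collect_le csnd continuous_intros)
    then have clT2: "closedin (top_of_set (T1 \<union> T2)) T2" by (simp add: TT)
    have "continuous_on (T1 \<union> T2) (\<lambda>p. if snd p x \<le> 1/2 then B p else C p)"
      using B C[folded T2_def] BC
      by (intro continuous_on_cases_local[OF clT1 clT2]) (auto simp: T1_def, auto simp: T2')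
    then have "continuous_on (S \<union> T) (\<lambda>p. if snd p x = 0 then A p else if snd p x \<le> 1/2 then B p else C p)"
      using A AB by (intro continuous_on_cases_local[OF clS clT]) (auto simp: TT[symmetric] S_def T_def)
    then show ?thesis by (simp add: ST)
  qed
  have hcont: "continuous_on S (\<lambda>p. h (\<sigma> p, nv (snd p)))"
    if "S \<subseteq> {p \<in> Z. snd p \<in> star \<and> snd p x \<le> 1/2}" "continuous_on S \<sigma>" "\<And>p. p \<in> S \<Longrightarrow> \<sigma> p \<in> {0..1}" for S \<sigma>
    using that nvL by (intro continuous_on_compose2[OF hc] continuous_intros continuous_on_compose2[OF nvc[of UNIV]])
        (auto simp: Z_def)
  \<comment> \<open>The time \<open>min 1 (4 * u x)\<close> is 0 on the base, where \<open>r\<close>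
    has to be the identity, and 1 at \<open>u x = 1/2\<close>, where \<open>r\<close> has to meet
    the constant \<open>a\<close>. The first component of \<open>p\<close> is ignored; it is there
    so that \<open>paste\<close> applies.\<close>
  define r where "r = (\<lambda>p :: real \<times> ('a \<Rightarrow> real). if snd p x = 0 then snd p else if snd p x \<le> 1/2 then h (min 1 (4 * snd p x), nv (snd p)) else a)"
  have rc: "continuous_on Z r"
    unfolding r_def
  proof (rule paste)
    show "continuous_on {p \<in> Z. snd p \<in> star \<and> snd p x \<le> 1/2} (\<lambda>p. h (min 1 (4 * snd p x), nv (snd p)))"
      by (rule hcont) (auto intro!: continuous_intros csnd X01 simp: Z_def)
  qed (use nvL h1 in \<open>auto intro!: continuous_intros simp: Z_def nv0 h0 dest: nvL\<close>)
  \<comment> \<open>Doubling \<open>u x\<close> makes the apex the image of everything with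
    \<open>u x \<ge> 1/2\<close>. The contraction is scaled by \<open>fst p\<close>: at time 0 the
    base direction is untouched, at time 1 it is the one of \<open>r\<close>. At the apex the base
    direction is lost, so the choice of \<open>a\<close> in \<open>cone 1 a\<close> is
    immaterial.\<close>
  define G where "G = (\<lambda>p. if snd p x = 0 then snd p else
     if snd p x \<le> 1/2 then cone (2 * snd p x) (h (fst p * min 1 (4 * snd p x), nv (snd p))) else cone 1 a)"
  have ccone: "continuous_on S (\<lambda>p. cone (f p) (g p))" if "continuous_on S f" "continuous_on S g"
    for S and f :: "real \<times> ('a \<Rightarrow> real) \<Rightarrow> real" and g
  proof (rule continuous_on_coordinatewise_then_product)
    fix y show "continuous_on S (\<lambda>p. cone (f p) (g p) y)"
      unfolding cone_def using that continuous_on_coord[OF that(2)]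
      by (cases "y = x") (auto intro!: continuous_intros)
  qed
  have cone0: "cone 0 v = v" if "v x = 0" for v using that by (auto simp: cone_def fun_eq_iff)
  have cone1: "cone 1 v = cone 1 w" for v w by (auto simp: cone_def fun_eq_iff)
  have Gc: "continuous_on Z G"
    unfolding G_def
  proof (rule paste)
    show "continuous_on {p \<in> Z. snd p \<in> star \<and> snd p x \<le> 1/2}
       (\<lambda>p. cone (2 * snd p x) (h (fst p * min 1 (4 * snd p x), nv (snd p))))"
    proof (intro ccone hcont continuous_intros csnd)
      show "fst p * min 1 (4 * snd p x) \<in> {0..1}" if "p \<in> {p \<in> Z. snd p \<in> star \<and> snd p x \<le> 1/2}" for p
        using that m01 by (auto simp: Z_def)
    qed auto
  next
    fix p assume p: "p \<in> Z" "snd p \<in> star" "snd p x = 0"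
    then have "nv (snd p) \<in> order_complex le L" using nvL by (auto simp: Z_def)
    then show "snd p = cone (2 * snd p x) (h (fst p * min 1 (4 * snd p x), nv (snd p)))"
      using p by (simp add: nv0 h0 cone0)
  next
    fix p :: "real \<times> ('a \<Rightarrow> real)" assume "snd p x = 1/2"
    then have "2 * snd p x = 1" by simp
    then show "cone (2 * snd p x) (h (fst p * min 1 (4 * snd p x), nv (snd p))) = cone 1 a"
      using cone1 by metis
  qed (auto intro!: continuous_intros)
  have Gm: "G p \<in> X" if p: "p \<in> Z" for p
  proof -
    have u: "snd p \<in> X" "fst p \<in> {0..1}" using p by (auto simp: Z_def)
    have "h (fst p * min 1 (4 * snd p x), nv (snd p)) \<in> order_complex le L" if "snd p x \<noteq> 0" "snd p x \<le> 1/2"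
    proof -
      have "nv (snd p) \<in> order_complex le L" using that u nvL starX by blast
      moreover have "fst p * min 1 (4 * snd p x) \<in> {0..1}" using u m01 by blast
      ultimately show ?thesis using hm by blast
    qed
    then show ?thesis unfolding G_def using u X01[OF u(1)] by (auto intro!: coneX)
  qed
  have rL: "r (s, u) \<in> order_complex le L" if "u \<in> X" "u x \<noteq> 0" for s u
    unfolding r_def using that aL nvL[OF that(1) starX[OF that]] X01[OF that(1)] hm
    by auto
  have rP: "r (s, u) \<in> order_complex le P" if "u \<in> X" for s u
    using that rL[OF that] LX by (cases "u x = 0") (auto simp: r_def PX)
  have embc: "continuous_on X (\<lambda>u. g (s, u))" if "continuous_on Z g" "s \<in> {0..1}" for g :: "real \<times> ('a \<Rightarrow> real) \<Rightarrow> ('a \<Rightarrow> real)" and s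
    by (rule continuous_on_compose2[OF that(1)]) (use that(2) in \<open>auto intro!: continuous_intros simp: Z_def\<close>)
  have G0: "G (0, u) y \<noteq> 0 \<Longrightarrow> y = x \<or> u y \<noteq> 0" if "u \<in> X" for u y
    using nvL[OF that starX[OF that]] by (auto simp: G_def cone_def h0 nv_def split: if_splits)
  have G1: "G (1, u) y \<noteq> 0 \<Longrightarrow> y = x \<or> r (1, u) y \<noteq> 0" if "u \<in> X" for u y
    by (auto simp: G_def r_def cone_def split: if_splits)
  have PsubX: "order_complex le P \<subseteq> X" using PX by auto
  have rX: "r (s, u) \<in> X" if "u \<in> X" for s u using rP[OF that] PsubX by blast
  have comp: "le b c \<or> le c b" if "u \<in> X" "u b \<noteq> 0" "c = x \<or> u c \<noteq> 0" "u x \<noteq> 0" for u b c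
    using that order_complexD(4) unfolding X_def by metis
  have H1: "homotopic_with_canon (\<lambda>_. True) X X (\<lambda>u. u) (\<lambda>u. G (0, u))"
    unfolding X_def
  proof (rule straight_line_homotopic)
    fix u b c assume "u \<in> order_complex le (insert x P)" "u b \<noteq> 0" "G (0, u) c \<noteq> 0"
    then have u: "u \<in> X" "c = x \<or> u c \<noteq> 0" "u b \<noteq> 0" using G0 by (auto simp: X_def)
    show "le b c \<or> le c b"
    proof (cases "u x = 0")
      case True
      then have "u c \<noteq> 0" using \<open>G (0, u) c \<noteq> 0\<close> by (auto simp: G_def)
      then show ?thesis using u order_complexD(4) unfolding X_def by metis
    qed (use comp u in blast)
  qed (use embc[OF Gc] Gm in \<open>auto simp: X_def Z_def intro!: continuous_intros\<close>)
  have H2: "homotopic_with_canon (\<lambda>_. True) X X (\<lambda>u. G (0, u)) (\<lambda>u. G (1, u))"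
    using Gc Gm by (subst homotopic_with) (auto simp: Z_def intro!: exI[of _ G])
  have H3: "homotopic_with_canon (\<lambda>_. True) X X (\<lambda>u. G (1, u)) (\<lambda>u. r (1, u))"
    unfolding X_def
  proof (rule straight_line_homotopic)
    fix u b c assume "u \<in> order_complex le (insert x P)" "G (1, u) b \<noteq> 0" "r (1, u) c \<noteq> 0"
    then have u: "u \<in> X" "b = x \<or> r (1, u) b \<noteq> 0" using G1 by (auto simp: X_def)
    show "le b c \<or> le c b"
    proof (cases "u x = 0")
      case True
      then have "u b \<noteq> 0" "u c \<noteq> 0" using \<open>r (1, u) c \<noteq> 0\<close> \<open>G (1, u) b \<noteq> 0\<close> by (auto simp: G_def r_def)
      then show ?thesis using u order_complexD(4) unfolding X_def by metis
    next
      case False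
      note rl = rL[OF u(1) False, of 1]
      have "c \<in> L" using order_complexD(2)[OF rl] \<open>r (1, u) c \<noteq> 0\<close> by auto
      then show ?thesis using u(2) order_complexD(4)[OF rl _ \<open>r (1, u) c \<noteq> 0\<close>] L by auto
    qed
  qed (use embc[OF Gc] Gm embc[OF rc] rX in \<open>auto simp: X_def Z_def intro!: continuous_intros\<close>)
  have H: "homotopic_with_canon (\<lambda>_. True) X X (\<lambda>u. r (1, u)) id"
    using homotopic_with_trans[OF homotopic_with_trans[OF H1 H2] H3] by (simp add: homotopic_with_symD id_def)
  have "homotopic_with_canon (\<lambda>_. True) (order_complex le P) (order_complex le P) (\<lambda>u. r (1, u)) id"
  proof (rule homotopic_with_equal)
    show "continuous_map (top_of_set (order_complex le P)) (top_of_set (order_complex le P)) (\<lambda>u. r (1, u))"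
      using rP PsubX by (auto intro!: continuous_on_subset[OF embc[OF rc]])
  qed (use PX in \<open>auto simp: r_def\<close>)
  then show ?thesis
    unfolding homotopy_equivalent_space_def X_def[symmetric]
    using H rP PsubX embc[OF rc]
    by (intro exI[of _ "\<lambda>u. u"] exI[of _ "\<lambda>u. r (1, u)"]) (auto simp: o_def id_def)
qed

section \<open>Quillen's fibre lemma\<close>

definition finite_poset :: "('a \<Rightarrow> 'a \<Rightarrow> bool) \<Rightarrow> 'a set \<Rightarrow> bool" where
  "finite_poset le P \<longleftrightarrow> finite P \<and> (\<forall>x\<in>P. le x x) \<and> (\<forall>x\<in>P. \<forall>y\<in>P. le x y \<longrightarrow> le y x \<longrightarrow> x = y) \<and>
     (\<forall>x\<in>P. \<forall>y\<in>P. \<forall>z\<in>P. le x y \<longrightarrow> le y z \<longrightarrow> le x z)"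

text \<open>The empty set counts as contractible, but an empty link or fibre must be
  excluded.\<close>

definition contr_poset :: "('a \<Rightarrow> 'a \<Rightarrow> bool) \<Rightarrow> 'a set \<Rightarrow> bool" where
  "contr_poset le P \<longleftrightarrow> P \<noteq> {} \<and> contractible (order_complex le P)"

lemma finite_poset_subset: "finite_poset le P \<Longrightarrow> A \<subseteq> P \<Longrightarrow> finite_poset le A"
  unfolding finite_poset_def by (meson finite_subset subsetD)

lemma finite_poset_dual: "finite_poset le P \<Longrightarrow> finite_poset (\<lambda>x y. le y x) P"
  unfolding finite_poset_def by blast

text \<open>Being a chain is a symmetric condition. Hence statements about lower sets yield those
  about upper sets, and an order-reversing map is as good as a monotone one.\<close>

lemma order_complex_dual: "order_complex (\<lambda>x y. le y x) P = order_complex le P"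
  unfolding order_complex_def by blast

lemma contr_poset_dual: "contr_poset (\<lambda>x y. le y x) P = contr_poset le P"
  unfolding contr_poset_def order_complex_dual[of le P] by (rule refl)

lemma contr_poset_homotopy_eqv: "order_complex le P homotopy_eqv order_complex le' Q \<Longrightarrow> contr_poset le P \<Longrightarrow> Q \<noteq> {} \<Longrightarrow> contr_poset le' Q"
  by (auto simp: contr_poset_def dest: homotopy_equivalent_space_contractibility)

lemma contr_poset_cone:
  assumes "finite_poset le P" "x \<in> P" "\<And>y. y \<in> P \<Longrightarrow> le x y \<or> le y x"
  shows "contr_poset le P"
  using assms(2) contractible_order_complex_cone[of P x le, OF _ assms(2,3)] assms(1)
  unfolding contr_poset_def finite_poset_def by blast

lemma order_complex_remove_contr_poset:
  assumes P: "finite_poset le P" and N: "insert x N \<subseteq> P" "x \<notin> N" and L: "contr_poset le {y \<in> N. le x y \<or> le y x}"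
  shows "order_complex le N homotopy_eqv order_complex le (insert x N)"
proof (rule order_complex_remove_point)
  show "finite N" using P N(1) finite_subset[of "insert x N" P] by (simp add: finite_poset_def)
  show "le y y" if "y \<in> insert x N" for y
  proof -
    have "y \<in> P" using that N(1) by blast
    then show ?thesis using P by (simp add: finite_poset_def)
  qed
  show "{y \<in> N. le x y \<or> le y x} \<noteq> {}"
    using L unfolding contr_poset_def by (rule conjunct1)
  show "contractible (order_complex le {y \<in> N. le x y \<or> le y x})"
    using L unfolding contr_poset_def by (rule conjunct2)
qed (simp_all add: N)

text \<open>A join with a contractible factor is contractible. When a point \<open>b\<close> of
  \<open>B\<close> is removed, its link is \<open>A\<close> joined with the remaining points of
  \<open>B\<close> comparable to \<open>b\<close>. This has the same form, so one induction covers
  both the link and what is left.\<close>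

lemma contr_poset_join:
  assumes "finite_poset le P" "A \<subseteq> P" "B \<subseteq> P" "A \<inter> B = {}" "contr_poset le A" "\<And>a b. a \<in> A \<Longrightarrow> b \<in> B \<Longrightarrow> le a b"
  shows "contr_poset le (A \<union> B)"
proof -
  have "finite B" using assms finite_subset unfolding finite_poset_def by blast
  then show ?thesis using assms(3,4,6)
  proof (induction B rule: finite_psubset_induct)
    case (psubset B)
    show ?case
    proof (cases "B = {}")
      case False
      obtain b where b: "b \<in> B" by (use False in auto)
      define L where "L = {y \<in> A \<union> (B - {b}). le b y \<or> le y b}"
      define B' where "B' = {y \<in> B - {b}. le b y \<or> le y b}"
      have L: "L = A \<union> B'" unfolding L_def B'_def using psubset.prems b by auto
      have "contr_poset le (A \<union> B')" using psubset.prems b by (intro psubset.IH) (auto simp: B'_def)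
      then have cL: "contr_poset le L" by (simp add: L)
      have ne: "A \<noteq> {}" using assms(5) by (auto simp: contr_poset_def)
      have "order_complex le (A \<union> (B - {b})) homotopy_eqv order_complex le (insert b (A \<union> (B - {b})))"
        using psubset.prems b assms(2)
        by (intro order_complex_remove_contr_poset[OF assms(1) _ _ cL[unfolded L_def]]) auto
      moreover have "contr_poset le (A \<union> (B - {b}))" using psubset.prems b by (intro psubset.IH) auto
      moreover have "insert b (A \<union> (B - {b})) = A \<union> B" using b by auto
      ultimately show ?thesis using ne by (auto intro: contr_poset_homotopy_eqv)
    qed (use assms in auto)
  qed
qed

lemma contr_poset_join':
  assumes "finite_poset le P" "A \<subseteq> P" "B \<subseteq> P" "A \<inter> B = {}" "contr_poset le B" "\<And>a b. a \<in> A \<Longrightarrow> b \<in> B \<Longrightarrow> le a b"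
  shows "contr_poset le (A \<union> B)"
proof -
  have "B \<inter> A = {}" using assms(4) by blast
  from contr_poset_join[OF finite_poset_dual[OF assms(1)] assms(3,2) this] assms(5,6)
  have "contr_poset le (B \<union> A)" unfolding contr_poset_dual[of le] by blast
  then show ?thesis by (simp add: Un_commute)
qed

lemma finite_poset_minimal:
  assumes "finite_poset le P" "A \<subseteq> P" "A \<noteq> {}"
  obtains m where "m \<in> A" "\<And>y. y \<in> A \<Longrightarrow> le y m \<Longrightarrow> y = m"
proof -
  have A: "finite_poset le A" using assms finite_poset_subset by blast
  define m where "m = arg_min_on (\<lambda>m. card {z\<in>A. le z m}) A"
  have "finite A" using A by (simp add: finite_poset_def)
  note am = arg_min_if_finite[OF this assms(3), of "\<lambda>m. card {z\<in>A. le z m}", folded m_def]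
  have m: "m \<in> A" "\<And>y. y \<in> A \<Longrightarrow> card {z\<in>A. le z m} \<le> card {z\<in>A. le z y}"
    using am by (auto simp: not_less)
  have "y = m" if y: "y \<in> A" "le y m" for y
  proof (rule ccontr)
    assume "y \<noteq> m"
    then have "\<not> le m y" using A m(1) y unfolding finite_poset_def by blast
    then have "{z\<in>A. le z y} \<subset> {z\<in>A. le z m}" using A m(1) y unfolding finite_poset_def by blast
    then have "card {z\<in>A. le z y} < card {z\<in>A. le z m}"
      using A by (intro psubset_card_mono) (auto simp: finite_poset_def)
    then show False using m(2)[OF y(1)] by simp
  qed
  then show ?thesis using m that by blast
qed

text \<open>The mapping cylinder of \<open>f\<close> as a poset: comparisons between the two ends go
  only from the source up to the target.\<close>

fun cyl_le :: "('a \<Rightarrow> 'a \<Rightarrow> bool) \<Rightarrow> ('b \<Rightarrow> 'b \<Rightarrow> bool) \<Rightarrow> ('a \<Rightarrow> 'b) \<Rightarrow> 'a + 'b \<Rightarrow> 'a + 'b \<Rightarrow> bool" where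
  "cyl_le le le' f (Inl x) (Inl y) = le x y"
| "cyl_le le le' f (Inl x) (Inr y) = le' (f x) y"
| "cyl_le le le' f (Inr x) (Inl y) = False"
| "cyl_le le le' f (Inr x) (Inr y) = le' x y"

lemma order_complex_image_homotopy_eqv:
  assumes inj: "inj_on f P" and f: "\<And>x y. x \<in> P \<Longrightarrow> y \<in> P \<Longrightarrow> le' (f x) (f y) \<longleftrightarrow> le x y"
  shows "order_complex le P homotopy_eqv order_complex le' (f ` P)"
proof -
  define F where "F = (\<lambda>(u :: 'a \<Rightarrow> real) y. if y \<in> f ` P then u (inv_into P f y) else 0)"
  define G where "G = (\<lambda>(v :: 'b \<Rightarrow> real) x. if x \<in> P then v (f x) else 0)"
  have Fc: "continuous_on S F" for S
    unfolding F_def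
  proof (rule continuous_on_coordinatewise_then_product)
    fix y show "continuous_on S (\<lambda>u :: 'a \<Rightarrow> real. if y \<in> f ` P then u (inv_into P f y) else 0)"
      by (cases "y \<in> f ` P") (simp_all add: continuous_on_coord[OF continuous_on_id])
  qed
  have Gc: "continuous_on S G" for S
    unfolding G_def
  proof (rule continuous_on_coordinatewise_then_product)
    fix x show "continuous_on S (\<lambda>v :: 'b \<Rightarrow> real. if x \<in> P then v (f x) else 0)"
      by (cases "x \<in> P") (simp_all add: continuous_on_coord[OF continuous_on_id])
  qed
  have s1: "sum (F u) (f ` P) = sum u P" for u
    by (subst sum.reindex[OF inj]) (auto simp: F_def inj intro!: sum.cong)
  have s2: "sum (G v) P = sum v (f ` P)" for v
    by (subst sum.reindex[OF inj]) (auto simp: G_def intro!: sum.cong)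
  have F: "F u \<in> order_complex le' (f ` P)" if "u \<in> order_complex le P" for u
  proof -
    have "le' y z \<or> le' z y" if nz: "F u y \<noteq> 0" "F u z \<noteq> 0" for y z
    proof -
      obtain a b where ab: "a \<in> P" "b \<in> P" "y = f a" "z = f b"
        using nz by (auto simp: F_def split: if_splits)
      then have "u a \<noteq> 0" "u b \<noteq> 0" using nz inj by (auto simp: F_def)
      then show ?thesis using order_complexD(4)[OF \<open>u \<in> order_complex le P\<close>] ab f by blast
    qed
    then show ?thesis unfolding order_complex_def mem_Collect_eq s1 using order_complexD(1-3)[OF that] by (simp add: F_def)
  qed
  have G: "G v \<in> order_complex le P" if "v \<in> order_complex le' (f ` P)" for v
  proof -
    have "le y z \<or> le z y" if nz: "G v y \<noteq> 0" "G v z \<noteq> 0" for y z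
      using order_complexD(4)[OF \<open>v \<in> order_complex le' (f ` P)\<close>, of "f y" "f z"] nz f by (auto simp: G_def split: if_splits)
    then show ?thesis unfolding order_complex_def mem_Collect_eq s2 using order_complexD(1-3)[OF that] by (simp add: G_def)
  qed
  have GF: "G (F u) = u" if "u \<in> order_complex le P" for u
    using order_complexD(2)[OF that] inj by (auto simp: F_def G_def fun_eq_iff)
  have FG: "F (G v) = v" if "v \<in> order_complex le' (f ` P)" for v
    using order_complexD(2)[OF that] by (auto simp: F_def G_def fun_eq_iff f_inv_into_f inv_into_into)
  have "order_complex le P homeomorphic order_complex le' (f ` P)"
    unfolding homeomorphic_def
    by (rule exI[of _ F], rule exI[of _ G], rule homeomorphismI[OF Fc Gc]) (use F G FG GF in auto)
  then show ?thesis by (rule homeomorphic_imp_homotopy_eqv)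
qed

text \<open>The points of either end of the mapping cylinder have contractible links once they are removed
  in the right order.\<close>

theorem quillen_fibre:
  fixes f :: "'a \<Rightarrow> 'b"
  assumes P: "finite_poset le P" and Q: "finite_poset le' Q" and fPQ: "\<And>x. x \<in> P \<Longrightarrow> f x \<in> Q"
    and mono: "\<And>x y. x \<in> P \<Longrightarrow> y \<in> P \<Longrightarrow> le x y \<Longrightarrow> le' (f x) (f y)"
    and fib: "\<And>q. q \<in> Q \<Longrightarrow> contr_poset le {x \<in> P. le' (f x) q}"
  shows "order_complex le P homotopy_eqv order_complex le' Q"
proof -
  define M where "M = cyl_le le le' f"
  define iP iQ where "iP = (Inl ` P :: ('a+'b) set)" and "iQ = (Inr ` Q :: ('a+'b) set)"
  have pM: "finite_poset M (iP \<union> iQ)"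
    unfolding finite_poset_def
  proof (intro conjI ballI impI)
    show "finite (iP \<union> iQ)" using P Q by (auto simp: iP_def iQ_def finite_poset_def)
    have l: "\<And>a. a \<in> P \<Longrightarrow> le a a" "\<And>a b. a \<in> P \<Longrightarrow> b \<in> P \<Longrightarrow> le a b \<Longrightarrow> le b a \<Longrightarrow> a = b"
        "\<And>a b c. a \<in> P \<Longrightarrow> b \<in> P \<Longrightarrow> c \<in> P \<Longrightarrow> le a b \<Longrightarrow> le b c \<Longrightarrow> le a c"
      using P unfolding finite_poset_def by blast+
    have l': "\<And>a. a \<in> Q \<Longrightarrow> le' a a" "\<And>a b. a \<in> Q \<Longrightarrow> b \<in> Q \<Longrightarrow> le' a b \<Longrightarrow> le' b a \<Longrightarrow> a = b"
        "\<And>a b c. a \<in> Q \<Longrightarrow> b \<in> Q \<Longrightarrow> c \<in> Q \<Longrightarrow> le' a b \<Longrightarrow> le' b c \<Longrightarrow> le' a c"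
      using Q unfolding finite_poset_def by blast+
    have mem: "Inl a \<in> iP \<union> iQ \<longleftrightarrow> a \<in> P" "Inr b \<in> iP \<union> iQ \<longleftrightarrow> b \<in> Q" for a b
      by (auto simp: iP_def iQ_def)
    show "M x x" if "x \<in> iP \<union> iQ" for x
      using that l(1) l'(1) by (cases x) (simp_all only: mem M_def cyl_le.simps)
    show "x = y" if "x \<in> iP \<union> iQ" "y \<in> iP \<union> iQ" "M x y" "M y x" for x y
    proof (cases x; cases y)
      fix a b assume "x = Inl a" "y = Inl b"
      then show ?thesis using that l(2)[of a b] by (simp only: mem M_def cyl_le.simps)
    next
      fix a b assume "x = Inr a" "y = Inr b"
      then show ?thesis using that l'(2)[of a b] by (simp only: mem M_def cyl_le.simps)
    qed (use that in \<open>simp_all only: M_def cyl_le.simps\<close>)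
    show "M x z" if "x \<in> iP \<union> iQ" "y \<in> iP \<union> iQ" "z \<in> iP \<union> iQ" "M x y" "M y z" for x y z
    proof (cases x; cases y; cases z)
      fix a b c assume "x = Inl a" "y = Inl b" "z = Inr c"
      then show ?thesis using that l'(3)[OF fPQ fPQ, of a b c] mono[of a b] by (simp only: mem M_def cyl_le.simps)
    next
      fix a b c assume "x = Inl a" "y = Inr b" "z = Inr c"
      then show ?thesis using that l'(3)[OF fPQ, of a b c] by (simp only: mem M_def cyl_le.simps)
    next
      fix a b c assume "x = Inl a" "y = Inl b" "z = Inl c"
      then show ?thesis using that l(3)[of a b c] by (simp only: mem M_def cyl_le.simps)
    next
      fix a b c assume "x = Inr a" "y = Inr b" "z = Inr c"
      then show ?thesis using that l'(3)[of a b c] by (simp only: mem M_def cyl_le.simps)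
    qed (use that in \<open>simp_all only: M_def cyl_le.simps\<close>)
  qed
  have inlL: "order_complex le A homotopy_eqv order_complex M (Inl ` A)" for A
    by (rule order_complex_image_homotopy_eqv) (auto simp: M_def)
  have inrL: "order_complex le' A homotopy_eqv order_complex M (Inr ` A)" for A
    by (rule order_complex_image_homotopy_eqv) (auto simp: M_def)
  have ctrl: "contr_poset M (Inl ` A)" if "contr_poset le A" for A
    using contr_poset_homotopy_eqv[OF inlL that] that by (auto simp: contr_poset_def)
  have ctrr: "contr_poset M (Inr ` A)" if "contr_poset le' A" for A
    using contr_poset_homotopy_eqv[OF inrL that] that by (auto simp: contr_poset_def)
  \<comment> \<open>The target is attached to the source from the top down. A minimal
    \<open>m\<close> of the upper set \<open>U\<close> comes last; its link is the fibre over
    \<open>m\<close> joined with the points strictly above \<open>m\<close>, hence contractible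
    because the fibre is.\<close>
  have A: "order_complex M iP homotopy_eqv order_complex M (iP \<union> (Inr ` U))"
    if "U \<subseteq> Q" "\<And>x y. x \<in> U \<Longrightarrow> y \<in> Q \<Longrightarrow> le' x y \<Longrightarrow> y \<in> U" for U
  proof -
    have "finite U" using that(1) Q finite_subset by (auto simp: finite_poset_def)
    then show ?thesis using that
    proof (induction U rule: finite_psubset_induct)
      case (psubset U)
      show ?case
      proof (cases "U = {}")
        case False
        obtain m where m: "m \<in> U" "\<And>y. y \<in> U \<Longrightarrow> le' y m \<Longrightarrow> y = m"
          using finite_poset_minimal[OF Q psubset.prems(1) False] by blast
        have mQ: "m \<in> Q" using m psubset.prems by auto
        define N where "N = iP \<union> Inr ` (U - {m})"
        define L where "L = {y \<in> N. M (Inr m) y \<or> M y (Inr m)}"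
        have L: "L = Inl ` {x \<in> P. le' (f x) m} \<union> Inr ` {y \<in> U - {m}. le' m y}"
          using m(2) by (auto simp: L_def N_def iP_def M_def)
        have "contr_poset M L" unfolding L
        proof (rule contr_poset_join[OF pM _ _ _ ctrl[OF fib[OF mQ]]])
          have tr: "\<And>a b c. a \<in> Q \<Longrightarrow> b \<in> Q \<Longrightarrow> c \<in> Q \<Longrightarrow> le' a b \<Longrightarrow> le' b c \<Longrightarrow> le' a c"
            using Q unfolding finite_poset_def by blast
          show "M a b" if ab: "a \<in> Inl ` {x \<in> P. le' (f x) m}" "b \<in> Inr ` {y \<in> U - {m}. le' m y}" for a b
          proof -
            obtain x y where "a = Inl x" "b = Inr y" "x \<in> P" "y \<in> Q" "le' (f x) m" "le' m y"
              using ab psubset.prems(1) by blast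
            then show ?thesis using tr[OF fPQ mQ, of x y] by (simp add: M_def)
          qed
        qed (use psubset.prems in \<open>auto simp: iP_def iQ_def\<close>)
        moreover have "N \<subseteq> iP \<union> iQ" "Inr m \<in> iP \<union> iQ" "Inr m \<notin> N"
          using psubset.prems mQ by (auto simp: N_def iQ_def iP_def)
        ultimately have "order_complex M N homotopy_eqv order_complex M (insert (Inr m) N)"
          unfolding L_def by (intro order_complex_remove_contr_poset[OF pM]) simp_all
        then have stp: "order_complex M N homotopy_eqv order_complex M (iP \<union> Inr ` U)"
          using m(1) by (simp add: N_def insert_absorb flip: Un_insert_right image_insert)
        have "order_complex M iP homotopy_eqv order_complex M N" unfolding N_def
        proof (rule psubset.IH)
          show "y \<in> U - {m}" if "x \<in> U - {m}" "y \<in> Q" "le' x y" for x y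
            using that psubset.prems(2)[of x y] m(2)[of x] by auto
        qed (use m psubset.prems in auto)
        then show ?thesis by (rule homotopy_eqv_trans[OF _ stp])
      qed (simp add: homotopy_equivalent_space_refl)
    qed
  qed
  \<comment> \<open>The source is attached to the target from the bottom up. The link of a maximal
    \<open>m\<close> of the lower set \<open>U\<close> consists of the points strictly below
    \<open>m\<close> joined with the elements of \<open>Q\<close> above \<open>f m\<close>, a cone
    with apex \<open>f m\<close>.\<close>
  have B: "order_complex M iQ homotopy_eqv order_complex M (Inl ` U \<union> iQ)"
    if "U \<subseteq> P" "\<And>x y. x \<in> U \<Longrightarrow> y \<in> P \<Longrightarrow> le y x \<Longrightarrow> y \<in> U" for U
  proof -
    have "finite U" using that(1) P finite_subset by (auto simp: finite_poset_def)
    then show ?thesis using that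
    proof (induction U rule: finite_psubset_induct)
      case (psubset U)
      show ?case
      proof (cases "U = {}")
        case False
        obtain m where m: "m \<in> U" "\<And>y. y \<in> U \<Longrightarrow> le m y \<Longrightarrow> y = m"
          using finite_poset_minimal[OF finite_poset_dual[OF P] psubset.prems(1) False] by blast
        have mP: "m \<in> P" using m psubset.prems by auto
        define N where "N = Inl ` (U - {m}) \<union> iQ"
        define L where "L = {y \<in> N. M (Inl m) y \<or> M y (Inl m)}"
        have L: "L = Inl ` {x \<in> U - {m}. le x m} \<union> Inr ` {y \<in> Q. le' (f m) y}"
          using m(2) by (auto simp: L_def N_def iQ_def M_def)
        have refl: "le' (f m) (f m)" using Q fPQ[OF mP] by (auto simp: finite_poset_def)
        have c: "contr_poset le' {y \<in> Q. le' (f m) y}"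
          using fPQ[OF mP] refl by (intro contr_poset_cone[OF finite_poset_subset[OF Q], of _ "f m"]) auto
        have "contr_poset M L" unfolding L
        proof (rule contr_poset_join'[OF pM _ _ _ ctrr[OF c]])
          have tr: "\<And>a b c. a \<in> Q \<Longrightarrow> b \<in> Q \<Longrightarrow> c \<in> Q \<Longrightarrow> le' a b \<Longrightarrow> le' b c \<Longrightarrow> le' a c"
            using Q unfolding finite_poset_def by blast
          show "M a b" if ab: "a \<in> Inl ` {x \<in> U - {m}. le x m}" "b \<in> Inr ` {y \<in> Q. le' (f m) y}" for a b
          proof -
            obtain x y where "a = Inl x" "b = Inr y" "x \<in> P" "y \<in> Q" "le x m" "le' (f m) y"
              using ab psubset.prems(1) by blast
            then show ?thesis using tr[OF fPQ fPQ[OF mP], of x y] mono[of x m] mP by (simp add: M_def)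
          qed
        qed (use psubset.prems in \<open>auto simp: iP_def iQ_def\<close>)
        moreover have "N \<subseteq> iP \<union> iQ" "Inl m \<in> iP \<union> iQ" "Inl m \<notin> N"
          using psubset.prems mP by (auto simp: N_def iQ_def iP_def)
        ultimately have "order_complex M N homotopy_eqv order_complex M (insert (Inl m) N)"
          unfolding L_def by (intro order_complex_remove_contr_poset[OF pM]) simp_all
        then have stp: "order_complex M N homotopy_eqv order_complex M (Inl ` U \<union> iQ)"
          using m(1) by (simp add: N_def insert_absorb flip: Un_insert_left image_insert)
        have "order_complex M iQ homotopy_eqv order_complex M N" unfolding N_def
        proof (rule psubset.IH)
          show "y \<in> U - {m}" if "x \<in> U - {m}" "y \<in> P" "le y x" for x y
            using that psubset.prems(2)[of x y] m(2)[of x] by auto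
        qed (use m psubset.prems in auto)
        then show ?thesis by (rule homotopy_eqv_trans[OF _ stp])
      qed (simp add: homotopy_equivalent_space_refl)
    qed
  qed
  have "order_complex M iP homotopy_eqv order_complex M (iP \<union> iQ)"
    unfolding iQ_def by (rule A) auto
  moreover have "order_complex M iQ homotopy_eqv order_complex M (iP \<union> iQ)"
    unfolding iP_def by (rule B) auto
  ultimately have "order_complex M iP homotopy_eqv order_complex M iQ"
    by (subst (asm) (2) homotopy_equivalent_space_sym) (rule homotopy_eqv_trans)
  moreover have "order_complex M iQ homotopy_eqv order_complex le' Q"
    unfolding iQ_def by (subst homotopy_equivalent_space_sym) (rule inrL)
  moreover have "order_complex le P homotopy_eqv order_complex M iP"
    unfolding iP_def by (rule inlL)
  ultimately show ?thesis by (blast intro: homotopy_eqv_trans)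
qed

section \<open>Products\<close>

text \<open>The elements of \<open>A\<close> above \<open>x\<close> form the Quillen fibre over
  \<open>x\<close> of the inclusion, taken with the order reversed.\<close>

lemma cofinal_homotopy_eqv:
  assumes P: "finite_poset le P" and A: "A \<subseteq> P" and cof: "\<And>x. x \<in> P \<Longrightarrow> contr_poset le {y \<in> A. le x y}"
  shows "order_complex le A homotopy_eqv order_complex le P"
proof -
  have "order_complex (\<lambda>x y. le y x) A homotopy_eqv order_complex (\<lambda>x y. le y x) P"
  proof (rule quillen_fibre[where f="\<lambda>x. x"])
    show "contr_poset (\<lambda>x y. le y x) {x \<in> A. le q x}" if "q \<in> P" for q
      unfolding contr_poset_dual[of le] by (rule cof[OF that])
  qed (use A finite_poset_dual[OF P] finite_poset_dual[OF finite_poset_subset[OF P A]] in auto)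
  then show ?thesis unfolding order_complex_dual[of le] .
qed

text \<open>The form in which most fibres are handled below: a fibre is cut down to a subfamily
  \<open>A\<close> of prescribed signs, whose parts above a given element are cones or families of
  the same kind.\<close>

lemma contr_poset_cofinal:
  assumes P: "finite_poset le P" and A: "A \<subseteq> P" "contr_poset le A" and cof: "\<And>x. x \<in> P \<Longrightarrow> contr_poset le {y \<in> A. le x y}"
  shows "contr_poset le P"
proof (rule contr_poset_homotopy_eqv[OF cofinal_homotopy_eqv[OF P A(1) cof] A(2)])
  show "P \<noteq> {}" using A by (auto simp: contr_poset_def)
qed

lemma contr_poset_image:
  assumes "inj_on f P" "\<And>x y. x \<in> P \<Longrightarrow> y \<in> P \<Longrightarrow> le' (f x) (f y) \<longleftrightarrow> le x y" "contr_poset le P"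
  shows "contr_poset le' (f ` P)"
proof (rule contr_poset_homotopy_eqv[OF order_complex_image_homotopy_eqv[where le=le and le'=le', OF assms(1,2)] assms(3)])
  show "f ` P \<noteq> {}" using assms(3) by (auto simp: contr_poset_def)
qed

section \<open>Products of finite posets\<close>

definition prod_le :: "('a \<Rightarrow> 'a \<Rightarrow> bool) \<Rightarrow> ('b \<Rightarrow> 'b \<Rightarrow> bool) \<Rightarrow> 'a \<times> 'b \<Rightarrow> 'a \<times> 'b \<Rightarrow> bool" where
  "prod_le le le' p q \<longleftrightarrow> le (fst p) (fst q) \<and> le' (snd p) (snd q)"

lemma prod_le_simp [simp]: "prod_le le le' (a, b) (c, d) \<longleftrightarrow> le a c \<and> le' b d"
  by (simp add: prod_le_def)

lemma finite_poset_prod: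
  assumes "finite_poset le P" "finite_poset le' Q"
  shows "finite_poset (prod_le le le') (P \<times> Q)"
proof -
  have l: "finite P" "\<And>a. a \<in> P \<Longrightarrow> le a a" "\<And>a b. a \<in> P \<Longrightarrow> b \<in> P \<Longrightarrow> le a b \<Longrightarrow> le b a \<Longrightarrow> a = b"
      "\<And>a b c. a \<in> P \<Longrightarrow> b \<in> P \<Longrightarrow> c \<in> P \<Longrightarrow> le a b \<Longrightarrow> le b c \<Longrightarrow> le a c"
    using assms(1) unfolding finite_poset_def by blast+
  have l': "finite Q" "\<And>a. a \<in> Q \<Longrightarrow> le' a a" "\<And>a b. a \<in> Q \<Longrightarrow> b \<in> Q \<Longrightarrow> le' a b \<Longrightarrow> le' b a \<Longrightarrow> a = b"
      "\<And>a b c. a \<in> Q \<Longrightarrow> b \<in> Q \<Longrightarrow> c \<in> Q \<Longrightarrow> le' a b \<Longrightarrow> le' b c \<Longrightarrow> le' a c"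
    using assms(2) unfolding finite_poset_def by blast+
  show ?thesis
    unfolding finite_poset_def
  proof (intro conjI ballI impI)
    show "finite (P \<times> Q)" using l(1) l'(1) by simp
    show "prod_le le le' x x" if "x \<in> P \<times> Q" for x
      using that l(2) l'(2) by (simp add: prod_le_def mem_Times_iff)
    show "x = y" if "x \<in> P \<times> Q" "y \<in> P \<times> Q" "prod_le le le' x y" "prod_le le le' y x" for x y
      using that l(3)[of "fst x" "fst y"] l'(3)[of "snd x" "snd y"]
      by (simp add: prod_le_def mem_Times_iff prod_eq_iff)
    show "prod_le le le' x z" if "x \<in> P \<times> Q" "y \<in> P \<times> Q" "z \<in> P \<times> Q" "prod_le le le' x y" "prod_le le le' y z" for x y z
      using that l(4)[of "fst x" "fst y" "fst z"] l'(4)[of "snd x" "snd y" "snd z"]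
      by (simp add: prod_le_def mem_Times_iff)
  qed
qed

text \<open>The projection to \<open>Q\<close> has contractible fibres: in
  \<open>P \<times> {y. y \<le> q}\<close> the slice \<open>P \<times> {q}\<close> is cofinal,
  because raising the second coordinate to \<open>q\<close> gives a least element of the slice above
  a given point.\<close>

lemma contr_poset_prod:
  assumes P: "finite_poset le P" and Q: "finite_poset le' Q" and cP: "contr_poset le P" and cQ: "contr_poset le' Q"
  shows "contr_poset (prod_le le le') (P \<times> Q)"
proof -
  have rP: "le x x" if "x \<in> P" for x using P that by (auto simp: finite_poset_def)
  have rQ: "le' x x" if "x \<in> Q" for x using Q that by (auto simp: finite_poset_def)
  have fib: "contr_poset (prod_le le le') {x \<in> P \<times> Q. le' (snd x) q}" if q: "q \<in> Q" for q
  proof (rule contr_poset_cofinal)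
    show "finite_poset (prod_le le le') {x \<in> P \<times> Q. le' (snd x) q}"
      by (rule finite_poset_subset[OF finite_poset_prod[OF P Q]]) auto
    have "contr_poset (prod_le le le') ((\<lambda>x. (x, q)) ` P)"
      using rQ[OF q] by (intro contr_poset_image[OF _ _ cP]) (auto intro: inj_onI)
    moreover have "(\<lambda>x. (x, q)) ` P = P \<times> {q}" by auto
    ultimately show "contr_poset (prod_le le le') (P \<times> {q})" by simp
    show "P \<times> {q} \<subseteq> {x \<in> P \<times> Q. le' (snd x) q}" using q rQ by auto
    show "contr_poset (prod_le le le') {y \<in> P \<times> {q}. prod_le le le' x y}" if "x \<in> {x \<in> P \<times> Q. le' (snd x) q}" for x
    proof (rule contr_poset_cone)
      show "finite_poset (prod_le le le') {y \<in> P \<times> {q}. prod_le le le' x y}"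
        using q by (intro finite_poset_subset[OF finite_poset_prod[OF P Q]]) auto
      show "(fst x, q) \<in> {y \<in> P \<times> {q}. prod_le le le' x y}"
        using that rP by (auto simp: prod_le_def)
      show "prod_le le le' (fst x, q) y \<or> prod_le le le' y (fst x, q)" if "y \<in> {y \<in> P \<times> {q}. prod_le le le' x y}" for y
        using that rQ[OF q] by (auto simp: prod_le_def)
    qed
  qed
  have "order_complex (prod_le le le') (P \<times> Q) homotopy_eqv order_complex le' Q"
    by (rule quillen_fibre[OF finite_poset_prod[OF P Q] Q _ _ fib]) (auto simp: prod_le_def)
  then have "order_complex le' Q homotopy_eqv order_complex (prod_le le le') (P \<times> Q)"
    by (subst homotopy_equivalent_space_sym)
  moreover have "P \<times> Q \<noteq> {}" using cP cQ by (simp add: contr_poset_def)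
  ultimately show ?thesis by (rule contr_poset_homotopy_eqv[OF _ cQ])
qed

text \<open>Along a chain the partial sums of \<open>v\<close> cut an interval into consecutive
  pieces, the piece of \<open>q\<close> having length \<open>v q\<close>; the end of one piece is
  the start of the next, so the differences of \<open>\<phi>\<close> telescope.\<close>

lemma chain_telescope:
  fixes v :: "'a \<Rightarrow> real" and \<phi> :: "real \<Rightarrow> real"
  assumes "finite_poset le C" "\<And>x y. x \<in> C \<Longrightarrow> y \<in> C \<Longrightarrow> le x y \<or> le y x"
  shows "(\<Sum>q\<in>C. \<phi> (\<Sum>x\<in>{x\<in>C. le x q}. v x) - \<phi> ((\<Sum>x\<in>{x\<in>C. le x q}. v x) - v q)) = \<phi> (sum v C) - \<phi> 0"
proof -
  have "finite C" using assms(1) by (simp add: finite_poset_def)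
  then show ?thesis using assms
  proof (induction C rule: finite_psubset_induct)
    case (psubset C)
    show ?case
    proof (cases "C = {}")
      case False
      obtain m where m: "m \<in> C" "\<And>y. y \<in> C \<Longrightarrow> le m y \<Longrightarrow> y = m"
        using finite_poset_minimal[OF finite_poset_dual[OF psubset.prems(1)] order_refl False] by blast
      have mx: "le y m" if "y \<in> C" for y
      proof -
        have "le m m" using psubset.prems(1) m(1) by (simp add: finite_poset_def)
        then show ?thesis using psubset.prems(2)[OF m(1) that] m(2)[OF that] by blast
      qed
      define C' where "C' = C - {m}"
      have fC: "finite C" using psubset.prems(1) by (simp add: finite_poset_def)
      have C: "C = insert m C'" "m \<notin> C'" "finite C'" using m fC by (auto simp: C'_def)
      have e: "{x\<in>C. le x q} = {x\<in>C'. le x q}" if "q \<in> C'" for q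
        using that m(2)[of q] by (auto simp: C'_def)
      have e': "{x\<in>C. le x m} = C" using mx by auto
      have "(\<Sum>q\<in>C'. \<phi> (\<Sum>x\<in>{x\<in>C'. le x q}. v x) - \<phi> ((\<Sum>x\<in>{x\<in>C'. le x q}. v x) - v q)) = \<phi> (sum v C') - \<phi> 0"
      proof (rule psubset.IH)
        show "C' \<subset> C" using m by (auto simp: C'_def)
        show "finite_poset le C'" by (rule finite_poset_subset[OF psubset.prems(1)]) (auto simp: C'_def)
        show "le x y \<or> le y x" if "x \<in> C'" "y \<in> C'" for x y
          using that psubset.prems(2)[of x y] by (simp add: C'_def)
      qed
      moreover have "(\<Sum>q\<in>C'. \<phi> (\<Sum>x\<in>{x\<in>C. le x q}. v x) - \<phi> ((\<Sum>x\<in>{x\<in>C. le x q}. v x) - v q)) =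
          (\<Sum>q\<in>C'. \<phi> (\<Sum>x\<in>{x\<in>C'. le x q}. v x) - \<phi> ((\<Sum>x\<in>{x\<in>C'. le x q}. v x) - v q))"
        by (intro sum.cong) (auto simp: e)
      moreover have "sum v C - v m = sum v C'"
        unfolding C'_def using sum.remove[OF fC m(1), of v] by simp
      ultimately show ?thesis
        unfolding sum.remove[OF fC m(1), where g="\<lambda>q. \<phi> (sum v {x\<in>C. le x q}) - \<phi> (sum v {x\<in>C. le x q} - v q)"]
          e' C'_def[symmetric] by simp
    qed simp
  qed
qed

text \<open>The right end of the interval belonging to \<open>p\<close>; the left end is
  \<open>cum le P u p - u p\<close>. Over the support of a point of the order complex these
  intervals tile the unit interval.\<close>

definition cum :: "('a \<Rightarrow> 'a \<Rightarrow> bool) \<Rightarrow> 'a set \<Rightarrow> ('a \<Rightarrow> real) \<Rightarrow> 'a \<Rightarrow> real" where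
  "cum le P u p = sum u {x \<in> P. le x p}"

lemma cum_telescope:
  fixes \<phi> :: "real \<Rightarrow> real"
  assumes P: "finite_poset le P" and u: "u \<in> order_complex le P"
  shows "(\<Sum>p\<in>P. \<phi> (cum le P u p) - \<phi> (cum le P u p - u p)) = \<phi> 1 - \<phi> 0"
proof -
  define C where "C = {x \<in> P. u x \<noteq> 0}"
  have fin: "finite P" using P by (auto simp: finite_poset_def)
  have c: "cum le P u p = sum u {x\<in>C. le x p}" for p
    unfolding cum_def C_def using fin by (intro sum.mono_neutral_right) auto
  have "(\<Sum>p\<in>P. \<phi> (cum le P u p) - \<phi> (cum le P u p - u p)) = (\<Sum>p\<in>C. \<phi> (cum le P u p) - \<phi> (cum le P u p - u p))"
    using fin by (intro sum.mono_neutral_right) (auto simp: C_def)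
  also have "\<dots> = \<phi> (sum u C) - \<phi> 0"
    unfolding c using order_complexD(4)[OF u] by (intro chain_telescope finite_poset_subset[OF P]) (auto simp: C_def)
  also have "sum u C = sum u P" unfolding C_def using fin by (intro sum.mono_neutral_left) auto
  finally show ?thesis using order_complexD(3)[OF u] by simp
qed

lemma cum_bounds:
  assumes P: "finite_poset le P" and u: "u \<in> order_complex le P" and p: "p \<in> P"
  shows "0 \<le> cum le P u p - u p" "cum le P u p \<le> 1"
proof -
  have fin: "finite P" using P by (auto simp: finite_poset_def)
  have "u p \<le> cum le P u p" unfolding cum_def
    using fin p P order_complexD(1)[OF u] by (intro member_le_sum) (auto simp: finite_poset_def)
  then show "0 \<le> cum le P u p - u p" by simp
  have "cum le P u p \<le> sum u P" unfolding cum_def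
    using fin order_complexD(1)[OF u] by (intro sum_mono2) auto
  then show "cum le P u p \<le> 1" using order_complexD(3)[OF u] by simp
qed

lemma cum_step:
  assumes P: "finite_poset le P" and u: "u \<in> order_complex le P" and p: "p \<in> P" "p' \<in> P" "le p p'" "p \<noteq> p'"
  shows "cum le P u p \<le> cum le P u p' - u p'"
proof -
  have fin: "finite P" using P by (auto simp: finite_poset_def)
  have "\<not> le p' p" "le p' p'" using P p unfolding finite_poset_def by blast+
  have "cum le P u p + u p' = sum u (insert p' {x \<in> P. le x p})"
    using fin \<open>\<not> le p' p\<close> by (simp add: cum_def)
  also have "\<dots> \<le> cum le P u p'"
    unfolding cum_def
  proof (rule sum_mono2)
    show "insert p' {x \<in> P. le x p} \<subseteq> {x \<in> P. le x p'}"
      using p \<open>le p' p'\<close> P unfolding finite_poset_def by blast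
  qed (use fin order_complexD(1)[OF u] in auto)
  finally show ?thesis by simp
qed

text \<open>The inverse of the map to the pair of marginals: the monotone coupling, i.e. the overlaps of
  the intervals into which the two points cut the unit interval.\<close>

lemma order_complex_prod_homeomorphic:
  fixes le :: "'a \<Rightarrow> 'a \<Rightarrow> bool" and le' :: "'b \<Rightarrow> 'b \<Rightarrow> bool"
  assumes P: "finite_poset le P" and Q: "finite_poset le' Q"
  shows "order_complex (prod_le le le') (P \<times> Q) homeomorphic (order_complex le P \<times> order_complex le' Q)"
proof -
  have fP: "finite P" and fQ: "finite Q" using P Q by (auto simp: finite_poset_def)
  define M where "M = prod_le le le'"
  define f where "f = (\<lambda>w :: 'a \<times> 'b \<Rightarrow> real. (\<lambda>p. \<Sum>q\<in>Q. w (p, q), \<lambda>q. \<Sum>p\<in>P. w (p, q)))"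
  define ov where "ov = (\<lambda>(u :: 'a \<Rightarrow> real) (v :: 'b \<Rightarrow> real) p q.
     max 0 (min (cum le P u p) (cum le' Q v q) - max (cum le P u p - u p) (cum le' Q v q - v q)))"
  define g where "g = (\<lambda>(u, v) (p, q). ov u v p q)"
  have f1: "fst (f w) p = (\<Sum>q\<in>Q. w (p, q))" and f2: "snd (f w) q = (\<Sum>p\<in>P. w (p, q))" for w p q
    by (auto simp: f_def)
  have fc: "continuous_on S f" for S
    unfolding f_def
    by (intro continuous_on_Pair continuous_on_coordinatewise_then_product continuous_on_sum
        continuous_on_coord[OF continuous_on_id])
  have gc: "continuous_on S g" for S
  proof (rule continuous_on_coordinatewise_then_product)
    fix pq :: "'a \<times> 'b"
    have c1: "continuous_on S (\<lambda>z. fst z p)" for p and S :: "(('a \<Rightarrow> real) \<times> ('b \<Rightarrow> real)) set"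
      by (rule continuous_on_coord[OF continuous_on_fst[OF continuous_on_id]])
    have c2: "continuous_on S (\<lambda>z. snd z p)" for p and S :: "(('a \<Rightarrow> real) \<times> ('b \<Rightarrow> real)) set"
      by (rule continuous_on_coord[OF continuous_on_snd[OF continuous_on_id]])
    show "continuous_on S (\<lambda>z. g z pq)"
      unfolding g_def ov_def cum_def case_prod_unfold by (intro continuous_intros c1 c2)
  qed
  have fw: "f w \<in> order_complex le P \<times> order_complex le' Q" if w: "w \<in> order_complex M (P \<times> Q)" for w
  proof -
    have s: "sum w (P \<times> Q) = 1" by (rule order_complexD(3)[OF w])
    have "sum (fst (f w)) P = 1" unfolding f1 using s by (simp add: sum.cartesian_product)
    moreover have "sum (snd (f w)) Q = 1" unfolding f2 using s
      by (subst sum.swap) (simp add: sum.cartesian_product)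
    moreover have "0 \<le> fst (f w) p" "0 \<le> snd (f w) q" for p q
      unfolding f1 f2 by (auto intro!: sum_nonneg order_complexD(1)[OF w])
    moreover have "fst (f w) p = 0" if "p \<notin> P" for p
      unfolding f1 using that order_complexD(2)[OF w] by (intro sum.neutral) auto
    moreover have "snd (f w) q = 0" if "q \<notin> Q" for q
      unfolding f2 using that order_complexD(2)[OF w] by (intro sum.neutral) auto
    moreover have "le p p' \<or> le p' p" if nz: "fst (f w) p \<noteq> 0" "fst (f w) p' \<noteq> 0" for p p'
    proof -
      obtain q where "w (p, q) \<noteq> 0"
        using nz(1) unfolding f1 by (rule sum.not_neutral_contains_not_neutral)
      moreover obtain q' where "w (p', q') \<noteq> 0"
        using nz(2) unfolding f1 by (rule sum.not_neutral_contains_not_neutral)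
      ultimately show ?thesis using order_complexD(4)[OF w, of "(p, q)" "(p', q')"] by (auto simp: M_def)
    qed
    moreover have "le' q q' \<or> le' q' q" if nz: "snd (f w) q \<noteq> 0" "snd (f w) q' \<noteq> 0" for q q'
    proof -
      obtain p where "w (p, q) \<noteq> 0"
        using nz(1) unfolding f2 by (rule sum.not_neutral_contains_not_neutral)
      moreover obtain p' where "w (p', q') \<noteq> 0"
        using nz(2) unfolding f2 by (rule sum.not_neutral_contains_not_neutral)
      ultimately show ?thesis using order_complexD(4)[OF w, of "(p, q)" "(p', q')"] by (auto simp: M_def)
    qed
    ultimately have "fst (f w) \<in> order_complex le P" "snd (f w) \<in> order_complex le' Q" unfolding order_complex_def by blast+
    then show ?thesis by (simp add: mem_Times_iff)
  qed
  \<comment> \<open>The length of the overlap of \<open>[a, b]\<close> and \<open>[c, d]\<close>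
    becomes the increment from \<open>c\<close> to \<open>d\<close> of the single function
    \<open>t \<mapsto> min b (max a t)\<close>. Summing over all \<open>[c, d]\<close> is then an
    instance of \<open>cum_telescope\<close>.\<close>
  have clamp: "max 0 (min b d - max a c) = min b (max a d) - min b (max a c)" if "a \<le> b" "c \<le> d" for a b c d :: real
    using that by linarith
  have ovQ: "(\<Sum>q\<in>Q. ov u v p q) = u p" if u: "u \<in> order_complex le P" and v: "v \<in> order_complex le' Q" and p: "p \<in> P" for u v p
  proof -
    define a b where "a = cum le P u p - u p" and "b = cum le P u p"
    have ab: "0 \<le> a" "a \<le> b" "b \<le> 1" using cum_bounds[OF P u p] order_complexD(1)[OF u, of p] by (auto simp: a_def b_def)
    have "(\<Sum>q\<in>Q. ov u v p q) = (\<Sum>q\<in>Q. min b (max a (cum le' Q v q)) - min b (max a (cum le' Q v q - v q)))"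
      unfolding ov_def unfolding a_def[symmetric] unfolding b_def[symmetric]
      by (intro sum.cong refl clamp) (use ab order_complexD(1)[OF v] in auto)
    also have "\<dots> = min b (max a 1) - min b (max a 0)" by (rule cum_telescope[OF Q v])
    also have "\<dots> = u p" using ab by (simp add: a_def b_def)
    finally show ?thesis .
  qed
  have ovP: "(\<Sum>p\<in>P. ov u v p q) = v q" if u: "u \<in> order_complex le P" and v: "v \<in> order_complex le' Q" and q: "q \<in> Q" for u v q
  proof -
    define a b where "a = cum le' Q v q - v q" and "b = cum le' Q v q"
    have ab: "0 \<le> a" "a \<le> b" "b \<le> 1" using cum_bounds[OF Q v q] order_complexD(1)[OF v, of q] by (auto simp: a_def b_def)
    have "(\<Sum>p\<in>P. ov u v p q) = (\<Sum>p\<in>P. min b (max a (cum le P u p)) - min b (max a (cum le P u p - u p)))"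
      unfolding ov_def unfolding a_def[symmetric] unfolding b_def[symmetric]
      by (intro sum.cong refl, subst clamp[symmetric]) (use ab order_complexD(1)[OF u] in \<open>auto simp: min.commute max.commute\<close>)
    also have "\<dots> = min b (max a 1) - min b (max a 0)" by (rule cum_telescope[OF P u])
    also have "\<dots> = v q" using ab by (simp add: a_def b_def)
    finally show ?thesis .
  qed
  have ov0: "p \<in> P \<and> q \<in> Q \<and> u p \<noteq> 0 \<and> v q \<noteq> 0 \<and> cum le P u p - u p < cum le' Q v q \<and> cum le' Q v q - v q < cum le P u p"
    if u: "u \<in> order_complex le P" and v: "v \<in> order_complex le' Q" and o: "ov u v p q \<noteq> 0" for u v p q
  proof -
    have "u p \<noteq> 0" "v q \<noteq> 0" using o by (auto simp: ov_def)
    then show ?thesis using order_complexD(2)[OF u, of p] order_complexD(2)[OF v, of q] o by (auto simp: ov_def)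
  qed
  have gw: "g (u, v) \<in> order_complex M (P \<times> Q)" if u: "u \<in> order_complex le P" and v: "v \<in> order_complex le' Q" for u v
  proof -
    have "sum (g (u, v)) (P \<times> Q) = (\<Sum>p\<in>P. \<Sum>q\<in>Q. ov u v p q)"
      by (simp add: sum.cartesian_product g_def)
    also have "\<dots> = sum u P" by (intro sum.cong refl ovQ[OF u v])
    finally have "sum (g (u, v)) (P \<times> Q) = 1" using order_complexD(3)[OF u] by simp
    moreover have "0 \<le> g (u, v) z" for z by (cases z) (simp add: g_def ov_def)
    moreover have "g (u, v) z = 0" if "z \<notin> P \<times> Q" for z
      using that ov0[OF u v] by (cases z) (auto simp: g_def)
    moreover have "M z z' \<or> M z' z" if z: "g (u, v) z \<noteq> 0" "g (u, v) z' \<noteq> 0" for z z'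
    proof -
      obtain p q p' q' where zz: "z = (p, q)" "z' = (p', q')" by (cases z; cases z')
      note a = ov0[OF u v, of p q] and b = ov0[OF u v, of p' q']
      have a: "p \<in> P" "q \<in> Q" "u p \<noteq> 0" "v q \<noteq> 0" "cum le P u p - u p < cum le' Q v q" "cum le' Q v q - v q < cum le P u p"
        and b: "p' \<in> P" "q' \<in> Q" "u p' \<noteq> 0" "v q' \<noteq> 0" "cum le P u p' - u p' < cum le' Q v q'" "cum le' Q v q' - v q' < cum le P u p'"
        using a b z by (auto simp: g_def zz)
      have pp: "le p p' \<or> le p' p" using order_complexD(4)[OF u] a b by blast
      have qq: "le' q q' \<or> le' q' q" using order_complexD(4)[OF v] a b by blast
      \<comment> \<open>For a crossed pair the interval of \<open>p\<close> ends before that of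
        \<open>p'\<close> begins and the interval of \<open>q'\<close> before that of
        \<open>q\<close>. As \<open>p\<close> overlaps \<open>q\<close> and \<open>p'\<close>
        overlaps \<open>q'\<close>, this closes a strict cycle of inequalities.\<close>
      have n1: "\<not> (le p p' \<and> p \<noteq> p' \<and> le' q' q \<and> q' \<noteq> q)"
        using cum_step[OF P u a(1) b(1)] cum_step[OF Q v b(2) a(2)] a b by linarith
      have n2: "\<not> (le p' p \<and> p' \<noteq> p \<and> le' q q' \<and> q \<noteq> q')"
        using cum_step[OF P u b(1) a(1)] cum_step[OF Q v a(2) b(2)] a b by linarith
      show ?thesis using pp qq n1 n2 by (auto simp: zz M_def)
    qed
    ultimately show ?thesis unfolding order_complex_def by blast
  qed
  have fg: "f (g (u, v)) = (u, v)" if u: "u \<in> order_complex le P" and v: "v \<in> order_complex le' Q" for u v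
  proof -
    have "fst (f (g (u, v))) p = u p" for p
    proof (cases "p \<in> P")
      case True
      then show ?thesis unfolding f1 by (simp add: g_def ovQ[OF u v])
    next
      case False
      then show ?thesis using order_complexD(2)[OF u] fw[OF gw[OF u v]] by (auto simp: mem_Times_iff dest!: order_complexD(2))
    qed
    moreover have "snd (f (g (u, v))) q = v q" for q
    proof (cases "q \<in> Q")
      case True
      then show ?thesis unfolding f2 by (simp add: g_def ovP[OF u v])
    next
      case False
      then show ?thesis using order_complexD(2)[OF v] fw[OF gw[OF u v]] by (auto simp: mem_Times_iff dest!: order_complexD(2))
    qed
    ultimately show ?thesis by (simp add: prod_eq_iff fun_eq_iff)
  qed
  have gf: "g (f w) = w" if w: "w \<in> order_complex M (P \<times> Q)" for w
  proof -
    define u v where "u = fst (f w)" and "v = snd (f w)"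
    have uv: "u \<in> order_complex le P" "v \<in> order_complex le' Q" using fw[OF w] by (auto simp: u_def v_def mem_Times_iff)
    have fwu: "f w = (u, v)" by (simp add: u_def v_def)
    note gin = gw[OF uv]
    have U: "cum le P u p = sum w {z \<in> P \<times> Q. le (fst z) p}" for p
    proof -
      have "{z \<in> P \<times> Q. le (fst z) p} = {x \<in> P. le x p} \<times> Q" by auto
      then show ?thesis unfolding cum_def u_def f1 by (simp add: sum.cartesian_product)
    qed
    have V: "cum le' Q v q = sum w {z \<in> P \<times> Q. le' (snd z) q}" for q
    proof -
      have "{z \<in> P \<times> Q. le' (snd z) q} = P \<times> {y \<in> Q. le' y q}" by auto
      then show ?thesis unfolding cum_def v_def f2
        by (subst sum.swap) (simp add: sum.cartesian_product)
    qed
    have cart: "sum w (A \<times> B) = (\<Sum>x\<in>A. \<Sum>y\<in>B. w (x, y))" for A B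
      by (simp add: sum.cartesian_product)
    have u': "u p = sum w {z \<in> P \<times> Q. fst z = p}" if "p \<in> P" for p
    proof -
      have "{z \<in> P \<times> Q. fst z = p} = {p} \<times> Q" using that by auto
      then show ?thesis unfolding u_def f1 by (simp add: cart)
    qed
    have v': "v q = sum w {z \<in> P \<times> Q. snd z = q}" if "q \<in> Q" for q
    proof -
      have "{z \<in> P \<times> Q. snd z = q} = P \<times> {q}" using that by auto
      then show ?thesis unfolding v_def f2 by (simp add: cart)
    qed
    have fPQ: "finite (P \<times> Q)" using fP fQ by simp
    have aP: "a = b" if "a \<in> P" "b \<in> P" "le a b" "le b a" for a b
      using P that unfolding finite_poset_def by blast
    have aQ: "a = b" if "a \<in> Q" "b \<in> Q" "le' a b" "le' b a" for a b
      using Q that unfolding finite_poset_def by blast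
    \<comment> \<open>The overlaps need not be computed: since \<open>w\<close> and
      \<open>g (f w)\<close> both have total weight 1, a pointwise inequality already forces
      equality.\<close>
    have le_g: "w z \<le> g (u, v) z" for z
    proof (cases "w z = 0")
      case True
      then show ?thesis by (cases z) (simp add: g_def ov_def)
    next
      case False
      obtain p q where z: "z = (p, q)" by (cases z)
      have pq: "p \<in> P" "q \<in> Q" using order_complexD(2)[OF w, of z] False z by auto
      have rp: "le p p" "le' q q" using P Q pq by (auto simp: finite_poset_def)
      have comp: "M x z \<or> M z x" if "w x \<noteq> 0" for x using order_complexD(4)[OF w that False] .
      have pos: "0 \<le> w x" for x by (rule order_complexD(1)[OF w])
      have "w z \<le> u p" unfolding u'[OF pq(1)] using fPQ pq by (intro member_le_sum) (auto simp: z pos)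
      moreover have "w z \<le> v q" unfolding v'[OF pq(2)] using fPQ pq by (intro member_le_sum) (auto simp: z pos)
      \<comment> \<open>A support point whose second coordinate is strictly below \<open>q\<close>
        must lie below \<open>z\<close>, the support being a chain. Its first coordinate is then
        below \<open>p\<close>, so its weight and that of \<open>z\<close> are all counted by
        \<open>cum le P u p\<close>.\<close>
      moreover have "w z + (cum le' Q v q - v q) \<le> cum le P u p"
      proof -
        define A where "A = {x \<in> P \<times> Q. le' (snd x) q \<and> snd x \<noteq> q \<and> w x \<noteq> 0}"
        have "{x \<in> P \<times> Q. le' (snd x) q} = {x \<in> P \<times> Q. snd x = q} \<union> {x \<in> P \<times> Q. le' (snd x) q \<and> snd x \<noteq> q}"
          using rp by auto
        then have "cum le' Q v q = v q + sum w {x \<in> P \<times> Q. le' (snd x) q \<and> snd x \<noteq> q}"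
          unfolding V v'[OF pq(2)] using fPQ by (simp add: sum.union_disjoint[symmetric] Int_def) 
        also have "sum w {x \<in> P \<times> Q. le' (snd x) q \<and> snd x \<noteq> q} = sum w A"
          using fPQ by (intro sum.mono_neutral_right) (auto simp: A_def)
        finally have 1: "w z + (cum le' Q v q - v q) = sum w (insert z A)"
          using fPQ by (simp add: A_def z)
        have "le (fst x) p" if "x \<in> A" for x
        proof -
          have "M x z"
          proof (rule ccontr)
            assume "\<not> M x z"
            then have "le' q (snd x)" using comp[of x] that by (auto simp: A_def M_def prod_le_def z)
            moreover have "le' (snd x) q" "snd x \<noteq> q" "snd x \<in> Q" using that by (auto simp: A_def)
            ultimately show False using aQ pq(2) by blast
          qed
          then show ?thesis by (auto simp: M_def prod_le_def z)
        qed
        then have "insert z A \<subseteq> {z \<in> P \<times> Q. le (fst z) p}" using pq rp by (auto simp: A_def z)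
        then show ?thesis unfolding 1 U using fPQ pos by (intro sum_mono2) auto
      qed
      moreover have "w z + (cum le P u p - u p) \<le> cum le' Q v q"
      proof -
        define A where "A = {x \<in> P \<times> Q. le (fst x) p \<and> fst x \<noteq> p \<and> w x \<noteq> 0}"
        have "{x \<in> P \<times> Q. le (fst x) p} = {x \<in> P \<times> Q. fst x = p} \<union> {x \<in> P \<times> Q. le (fst x) p \<and> fst x \<noteq> p}"
          using rp by auto
        then have "cum le P u p = u p + sum w {x \<in> P \<times> Q. le (fst x) p \<and> fst x \<noteq> p}"
          unfolding U u'[OF pq(1)] using fPQ by (simp add: sum.union_disjoint[symmetric] Int_def) 
        also have "sum w {x \<in> P \<times> Q. le (fst x) p \<and> fst x \<noteq> p} = sum w A"
          using fPQ by (intro sum.mono_neutral_right) (auto simp: A_def)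
        finally have 1: "w z + (cum le P u p - u p) = sum w (insert z A)"
          using fPQ by (simp add: A_def z)
        have "le' (snd x) q" if "x \<in> A" for x
        proof -
          have "M x z"
          proof (rule ccontr)
            assume "\<not> M x z"
            then have "le p (fst x)" using comp[of x] that by (auto simp: A_def M_def prod_le_def z)
            moreover have "le (fst x) p" "fst x \<noteq> p" "fst x \<in> P" using that by (auto simp: A_def)
            ultimately show False using aP pq(1) by blast
          qed
          then show ?thesis by (auto simp: M_def prod_le_def z)
        qed
        then have "insert z A \<subseteq> {z \<in> P \<times> Q. le' (snd z) q}" using pq rp by (auto simp: A_def z)
        then show ?thesis unfolding 1 V using fPQ pos by (intro sum_mono2) auto
      qed
      ultimately show ?thesis by (simp add: z g_def ov_def)
    qed
    have "sum (\<lambda>z. g (u, v) z - w z) (P \<times> Q) = 0"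
      using order_complexD(3)[OF gin] order_complexD(3)[OF w] by (simp add: sum_subtractf)
    then have "\<forall>z\<in>P \<times> Q. g (u, v) z - w z = 0"
      using sum_nonneg_eq_0_iff[OF fPQ, of "\<lambda>z. g (u, v) z - w z"] le_g by (simp only: diff_ge_0_iff_ge)
    then have "g (u, v) z = w z" if "z \<in> P \<times> Q" for z using that by auto
    then have "g (u, v) z = w z" for z
      using order_complexD(2)[OF gin, of z] order_complexD(2)[OF w, of z] by (cases "z \<in> P \<times> Q") auto
    then show ?thesis unfolding fwu by (simp add: fun_eq_iff)
  qed
  show ?thesis
    unfolding homeomorphic_def M_def[symmetric]
    by (rule exI[of _ f], rule exI[of _ g], rule homeomorphismI[OF fc gc]) (use fw gw fg gf in \<open>auto simp: image_subset_iff\<close>)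
qed

section \<open>Realizations and the octagon\<close>

lemma order_realization_homeomorphic:
  assumes "finite P"
  shows "order_realization P le homeomorphic_space top_of_set (order_complex le P)"
proof -
  define S where "S = {u \<in> topspace (powertop_real P).
          (\<forall>x\<in>P. 0 \<le> u x) \<and> sum u P = 1 \<and>
          (\<forall>x\<in>P. \<forall>y\<in>P. u x \<noteq> 0 \<and> u y \<noteq> 0 \<longrightarrow> le x y \<or> le y x)}"
  define f where "f = (\<lambda>(u :: 'a \<Rightarrow> real) x. if x \<in> P then u x else 0)"
  define g where "g = (\<lambda>v :: 'a \<Rightarrow> real. restrict v P)"
  have R: "order_realization P le = subtopology (powertop_real P) S"
    by (simp add: order_realization_def S_def)
  have fS: "f u \<in> order_complex le P" if "u \<in> S" for u
  proof -
    have "sum (f u) P = sum u P" by (intro sum.cong) (auto simp: f_def)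
    then show ?thesis using that by (auto simp: S_def f_def order_complex_def split: if_splits)
  qed
  have gS: "g v \<in> S" if "v \<in> order_complex le P" for v
    using order_complexD[OF that] by (auto simp: S_def g_def topspace_product_topology)
  have "continuous_map (subtopology (powertop_real P) S) euclidean f"
    unfolding euclidean_product_topology[symmetric] continuous_map_componentwise_UNIV
  proof
    fix x show "continuous_map (subtopology (powertop_real P) S) euclideanreal (\<lambda>u. f u x)"
    proof (cases "x \<in> P")
      case True
      then have "continuous_map (powertop_real P) euclideanreal (\<lambda>u. u x)"
        by (rule continuous_map_product_projection)
      then show ?thesis using True by (simp add: f_def continuous_map_from_subtopology)
    qed (simp add: f_def)
  qed
  then have 1: "continuous_map (order_realization P le) (top_of_set (order_complex le P)) f"
    using fS by (auto simp: R continuous_map_in_subtopology topspace_subtopology)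
  have "continuous_map (top_of_set (order_complex le P)) (powertop_real P) g"
    by (auto simp: continuous_map_componentwise g_def continuous_on_coord[OF continuous_on_id])
  then have 2: "continuous_map (top_of_set (order_complex le P)) (order_realization P le) g"
    using gS by (auto simp: R continuous_map_in_subtopology)
  have "g (f u) = u" if "u \<in> topspace (order_realization P le)" for u
    using that by (auto simp: R S_def f_def g_def topspace_product_topology PiE_def extensional_def fun_eq_iff)
  moreover have "f (g v) = v" if "v \<in> order_complex le P" for v
    using order_complexD(2)[OF that] by (auto simp: f_def g_def fun_eq_iff)
  ultimately show ?thesis
    unfolding homeomorphic_space_def homeomorphic_maps_def using 1 2
    by (intro exI[of _ f] exI[of _ g]) auto
qed

section \<open>Sign pairs and the circle\<close>

definition sg_le :: "sign \<Rightarrow> sign \<Rightarrow> bool" where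
  "sg_le a b \<longleftrightarrow> a = Zero \<or> a = b"

lemma UNIV_sign: "(UNIV :: sign set) = {Neg, Zero, Pos}"
  by (auto intro: sign.exhaust)

instance sign :: finite
  by standard (simp add: UNIV_sign)

text \<open>The sign patterns of nonzero complex numbers. The four half-axes are minimal, the four
  open quadrants maximal, and the order complex is a cycle of eight edges.\<close>

definition octagon :: "(sign \<times> sign) set" where
  "octagon = {(a, b). a \<noteq> Zero \<or> b \<noteq> Zero}"

fun sval :: "sign \<Rightarrow> real" where
  "sval Neg = -1" | "sval Zero = 0" | "sval Pos = 1"

lemma octagon_eq: "octagon = {(Pos, Zero), (Pos, Pos), (Zero, Pos), (Neg, Pos), (Neg, Zero), (Neg, Neg), (Zero, Neg), (Pos, Neg)}"
proof -
  have "(a, b) \<in> octagon \<longleftrightarrow> (a, b) \<in> {(Pos, Zero), (Pos, Pos), (Zero, Pos), (Neg, Pos), (Neg, Zero), (Neg, Neg), (Zero, Neg), (Pos, Neg)}" for a b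
    by (cases a; cases b; simp add: octagon_def)
  then show ?thesis by (intro set_eqI) (simp only: split_paired_all)
qed

lemma finite_poset_sg: "finite_poset sg_le S"
  by (auto simp: finite_poset_def sg_le_def intro: finite_subset[OF subset_UNIV])

abbreviation oct_le :: "sign \<times> sign \<Rightarrow> sign \<times> sign \<Rightarrow> bool" where
  "oct_le \<equiv> prod_le sg_le sg_le"

lemma finite_poset_octagon: "finite_poset oct_le octagon"
  by (rule finite_poset_subset[OF finite_poset_prod[OF finite_poset_sg[of UNIV] finite_poset_sg[of UNIV]]]) auto

definition square :: "(real \<times> real) set" where
  "square = {z. max \<bar>fst z\<bar> \<bar>snd z\<bar> = 1}"

text \<open>Barycentric coordinates on the boundary of the square, with half-axes placed at the
  midpoints of the sides and quadrants at the corners. On the side through \<open>(1, 0)\<close>,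
  the midpoint has weight \<open>1 - \<bar>y\<bar>\<close> and the nearer corner
  \<open>\<bar>y\<bar>\<close>.\<close>

definition oct_coord :: "real \<times> real \<Rightarrow> sign \<times> sign \<Rightarrow> real" where
  "oct_coord z p = (if snd p = Zero then (if fst p = Zero then 0 else max 0 (sval (fst p) * fst z - \<bar>snd z\<bar>))
     else if fst p = Zero then max 0 (sval (snd p) * snd z - \<bar>fst z\<bar>)
     else max 0 (min (sval (fst p) * fst z) (sval (snd p) * snd z)))"

lemma octagon_square: "order_complex oct_le octagon homeomorphic square"
proof -
  define f where "f = (\<lambda>u :: sign \<times> sign \<Rightarrow> real. (\<Sum>p\<in>octagon. u p * sval (fst p), \<Sum>p\<in>octagon. u p * sval (snd p)))"
  have fc: "continuous_on S f" for S
    unfolding f_def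
    by (intro continuous_on_Pair continuous_on_sum continuous_on_mult continuous_on_const continuous_on_coord[OF continuous_on_id])
  have gc: "continuous_on S oct_coord" for S
  proof (rule continuous_on_coordinatewise_then_product)
    fix p show "continuous_on S (\<lambda>z. oct_coord z p)"
      unfolding oct_coord_def by (cases "snd p = Zero"; cases "fst p = Zero") (auto intro!: continuous_intros)
  qed
  have g: "oct_coord z \<in> order_complex oct_le octagon \<and> f (oct_coord z) = z" if z: "z \<in> square" for z
  proof -
    obtain x y where xy: "z = (x, y)" by (cases z)
    have c: "x = 1 \<and> \<bar>y\<bar> \<le> 1 \<or> x = -1 \<and> \<bar>y\<bar> \<le> 1 \<or> y = 1 \<and> \<bar>x\<bar> \<le> 1 \<or> y = -1 \<and> \<bar>x\<bar> \<le> 1"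
      using z by (auto simp: square_def xy)
    have s: "sum h octagon = h (Pos, Zero) + h (Pos, Pos) + h (Zero, Pos) + h (Neg, Pos) + h (Neg, Zero) + h (Neg, Neg) + h (Zero, Neg) + h (Pos, Neg)" for h :: "sign \<times> sign \<Rightarrow> real"
      by (simp add: octagon_eq)
    have "sum (oct_coord z) octagon = 1" unfolding s using c
      by (elim disjE) (auto simp: oct_coord_def xy)
    moreover have "f (oct_coord z) = z" unfolding f_def s using c
      by (elim disjE) (auto simp: oct_coord_def xy)
    moreover have "0 \<le> oct_coord z p" for p by (simp add: oct_coord_def)
    moreover have "oct_coord z p = 0" if "p \<notin> octagon" for p
      using that by (cases p) (auto simp: oct_coord_def octagon_def)
    moreover have "oct_le p q \<or> oct_le q p" if "oct_coord z p \<noteq> 0" "oct_coord z q \<noteq> 0" for p q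
    proof -
      have pos: "(a \<noteq> Zero \<and> b \<noteq> Zero \<and> 0 < sval a * x \<and> 0 < sval b * y) \<or>
          (a \<noteq> Zero \<and> b = Zero \<and> \<bar>y\<bar> < sval a * x) \<or> (a = Zero \<and> b \<noteq> Zero \<and> \<bar>x\<bar> < sval b * y)"
        if "oct_coord z (a, b) \<noteq> 0" for a b
        using that by (auto simp: oct_coord_def xy max_def split: if_splits)
      have uniq: "a = a'" if "0 < sval a * r" "0 < sval a' * r" for a a' r
        using that by (cases a; cases a') auto
      have bd: "sval a * r \<le> \<bar>r\<bar>" for a r by (cases a) auto
      obtain a b a' b' where pq: "p = (a, b)" "q = (a', b')" by (cases p; cases q)
      have posx: "0 < sval c * r" if "\<bar>t\<bar> < sval c * r" for c r t using that by linarith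
      have excl: "\<not> (\<bar>y\<bar> < sval c * x \<and> \<bar>x\<bar> < sval d * y)" for c d
        using bd[of c x] bd[of d y] by linarith
      show ?thesis
        using pos[of a b] pos[of a' b'] that excl uniq[of a x a'] uniq[of b y b'] posx
        unfolding pq prod_le_simp sg_le_def by metis
    qed
    ultimately show ?thesis unfolding order_complex_def by blast
  qed
  have u: "f u \<in> square \<and> oct_coord (f u) = u" if u: "u \<in> order_complex oct_le octagon" for u
  proof -
    have s: "sum h octagon = h (Pos, Zero) + h (Pos, Pos) + h (Zero, Pos) + h (Neg, Pos) + h (Neg, Zero) + h (Neg, Neg) + h (Zero, Neg) + h (Pos, Neg)" for h :: "sign \<times> sign \<Rightarrow> real"
      by (simp add: octagon_eq)
    have ch: "u p = 0 \<or> u q = 0 \<or> oct_le p q \<or> oct_le q p" for p q using order_complexD(4)[OF u] by blast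
    have out: "u p = 0" if "p \<notin> octagon" for p by (rule order_complexD(2)[OF u that])
    \<comment> \<open>The support lies in one edge of the cycle, formed by a quadrant
      \<open>(a, b)\<close> and one of its bounding half-axes. If it is a single half-axis, the
      missing sign is chosen as \<open>Pos\<close>.\<close>
    obtain a b where ab: "a \<noteq> Zero" "b \<noteq> Zero"
      "(\<forall>p. u p \<noteq> 0 \<longrightarrow> p = (a, Zero) \<or> p = (a, b)) \<or> (\<forall>p. u p \<noteq> 0 \<longrightarrow> p = (Zero, b) \<or> p = (a, b))"
    proof -
      obtain p where p: "u p \<noteq> 0" using order_complexD(3)[OF u] by (metis sum.neutral zero_neq_one)
      show ?thesis
      proof (cases "\<exists>a b. a \<noteq> Zero \<and> b \<noteq> Zero \<and> u (a, b) \<noteq> 0")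
        case True
        then obtain a b where ab: "a \<noteq> Zero" "b \<noteq> Zero" "u (a, b) \<noteq> 0" by blast
        have "q = (a, Zero) \<or> q = (a, b) \<or> q = (Zero, b)" if "u q \<noteq> 0" for q
          using ch[of q "(a, b)"] ab out[of q] that
          by (cases q) (auto simp: octagon_def sg_le_def)
        moreover have "u (a, Zero) = 0 \<or> u (Zero, b) = 0"
          using ch[of "(a, Zero)" "(Zero, b)"] ab by (auto simp: sg_le_def)
        ultimately show ?thesis using that[OF ab(1,2)] by metis
      next
        case False
        have ev: "(fst q = Zero) \<noteq> (snd q = Zero)" if "u q \<noteq> 0" for q
        proof -
          have "q \<in> octagon" using out[of q] that by blast
          moreover have "fst q = Zero \<or> snd q = Zero" using False that by (metis prod.collapse)
          ultimately show ?thesis by (cases q) (auto simp: octagon_def)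
        qed
        have eq: "q = p" if "u q \<noteq> 0" for q
          using ch[of p q] p that ev[OF p] ev[OF that]
          by (auto simp: prod_le_def sg_le_def prod_eq_iff)
        obtain a b where "p = (a, Zero) \<and> a \<noteq> Zero \<or> p = (Zero, b) \<and> b \<noteq> Zero"
          using False p out[of p] by (cases p) (auto simp: octagon_def)
        then show ?thesis
          using that[of a Pos] that[of Pos b] eq by (metis sign.distinct(5))
      qed
    qed
    have pts: "u (c, d) = 0" if "(c, d) \<noteq> (a, b)" "\<not> (d = Zero \<and> c = a)" "\<not> (c = Zero \<and> d = b)" for c d
      using ab that by (metis prod.inject)
    have z: "u (a, Zero) = 0 \<or> u (Zero, b) = 0" using ab by (metis prod.inject)
    have "u (a, Zero) + u (a, b) + u (Zero, b) = 1 \<and> fst (f u) = sval a * (u (a, Zero) + u (a, b)) \<and>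
        snd (f u) = sval b * (u (Zero, b) + u (a, b))"
      using order_complexD(3)[OF u] ab(1,2) pts unfolding f_def s by (cases a; cases b; simp)
    then have sm: "u (a, Zero) + u (a, b) + u (Zero, b) = 1"
      and fu: "f u = (sval a * (u (a, Zero) + u (a, b)), sval b * (u (Zero, b) + u (a, b)))"
      by (auto simp: prod_eq_iff)
    have nn: "0 \<le> u (a, Zero)" "0 \<le> u (a, b)" "0 \<le> u (Zero, b)" using order_complexD(1)[OF u] by auto
    have sv: "\<bar>sval a * r\<bar> = \<bar>r\<bar>" "\<bar>sval b * r\<bar> = \<bar>r\<bar>" for r using ab by (cases a; cases b; simp)+
    have "f u \<in> square" unfolding square_def fu using z sm nn by (auto simp: sv)
    moreover have "oct_coord (f u) = u"
    proof -
      have sq: "sval a * (sval a * r) = r" "sval b * (sval b * r) = r" for r using ab by (cases a; cases b; simp)+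
      \<comment> \<open>Both sides have total weight 1, so the inequality suffices for
        equality.\<close>
      have "u p \<le> oct_coord (f u) p" for p
      proof -
        consider "p = (a, Zero)" | "p = (Zero, b)" | "p = (a, b)" | "u p = 0"
          using ab by metis
        then show ?thesis
        proof cases
          case 4
          then show ?thesis by (simp add: oct_coord_def)
        qed (use ab z nn in \<open>auto simp: fu oct_coord_def sq sv\<close>)
      qed
      moreover have g': "oct_coord (f u) \<in> order_complex oct_le octagon" using g \<open>f u \<in> square\<close> by blast
      ultimately have "\<forall>p\<in>octagon. oct_coord (f u) p - u p = 0"
        using order_complexD(3)[OF g'] order_complexD(3)[OF u]
        by (subst sum_nonneg_eq_0_iff[symmetric]) (auto simp: sum_subtractf octagon_eq)
      then have "oct_coord (f u) p = u p" for p
        using order_complexD(2)[OF g', of p] out[of p] by (cases "p \<in> octagon") auto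
      then show ?thesis by (simp add: fun_eq_iff)
    qed
    ultimately show ?thesis by auto
  qed
  show ?thesis
    unfolding homeomorphic_def
    by (rule exI[of _ f], rule exI[of _ oct_coord], rule homeomorphismI[OF fc gc]) (use g u in auto)
qed

text \<open>Radial projection; the inverse divides by the maximum norm \<open>m\<close>.\<close>

lemma square_circle: "square homeomorphic (sphere 0 1 :: complex set)"
proof -
  define f where "f = (\<lambda>z :: real \<times> real. Complex (fst z / norm z) (snd z / norm z))"
  define m where "m = (\<lambda>w :: complex. max \<bar>Re w\<bar> \<bar>Im w\<bar>)"
  define g where "g = (\<lambda>w :: complex. (Re w / m w, Im w / m w))"
  have nz: "norm z > 0" if "z \<in> square" for z using that by (auto simp: square_def)
  have mz: "m w > 0" if "w \<in> sphere 0 1" for w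
  proof -
    have "w \<noteq> 0" using that by auto
    then show ?thesis by (auto simp: m_def complex_eq_iff less_max_iff_disj)
  qed
  have fc: "continuous_on square f"
    unfolding f_def using nz
    by (intro continuous_intros) force+
  have gc: "continuous_on (sphere 0 1) g"
    unfolding g_def using mz
    by (intro continuous_intros) (force simp: m_def intro!: continuous_intros)+
  have f: "f z \<in> sphere 0 1" "g (f z) = z" if "z \<in> square" for z
  proof -
    note n = nz[OF that]
    have "(norm z)\<^sup>2 = (fst z)\<^sup>2 + (snd z)\<^sup>2" by (cases z) (simp add: norm_Pair)
    then show "f z \<in> sphere 0 1" using n
      by (simp add: f_def cmod_def power_divide flip: add_divide_distrib) (auto simp: prod_eq_iff)
    have "m (f z) = max (\<bar>fst z\<bar> / norm z) (\<bar>snd z\<bar> / norm z)" using n by (simp add: m_def f_def)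
    also have "\<dots> = max \<bar>fst z\<bar> \<bar>snd z\<bar> / norm z" using n by (simp add: max_def divide_right_mono frac_le field_simps)
    finally have "m (f z) = 1 / norm z" using that by (simp add: square_def)
    then show "g (f z) = z" using n by (cases z) (simp add: g_def, simp add: f_def)
  qed
  have g: "g w \<in> square" "f (g w) = w" if "w \<in> sphere 0 1" for w
  proof -
    note n = mz[OF that]
    have "max (\<bar>Re w\<bar> / m w) (\<bar>Im w\<bar> / m w) = max \<bar>Re w\<bar> \<bar>Im w\<bar> / m w" using n by (simp add: max_def field_simps)
    then show "g w \<in> square" using n by (simp add: square_def g_def m_def)
    have "norm (g w) = sqrt (((Re w)\<^sup>2 + (Im w)\<^sup>2) / (m w)\<^sup>2)"
      by (simp add: g_def norm_Pair power_divide add_divide_distrib)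
    also have "\<dots> = norm w / m w" using n by (simp add: cmod_def real_sqrt_divide)
    finally have "norm (g w) = 1 / m w" using that by simp
    then show "f (g w) = w" using n by (simp add: f_def complex_eq_iff) (simp add: g_def)
  qed
  show ?thesis
    unfolding homeomorphic_def
    by (rule exI[of _ f], rule exI[of _ g], rule homeomorphismI[OF fc gc]) (use f g in auto)
qed

lemma octagon_circle: "order_complex oct_le octagon homeomorphic (sphere 0 1 :: complex set)"
  using octagon_square square_circle by (rule homeomorphic_trans)

section \<open>Rotation of sign pairs\<close>

fun sign_mult :: "sign \<Rightarrow> sign \<Rightarrow> sign" where
  "sign_mult Zero b = Zero" | "sign_mult Pos b = b" | "sign_mult Neg b = sign_neg b"

fun sign_add :: "sign \<Rightarrow> sign \<Rightarrow> sign" where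
  "sign_add Zero b = b" | "sign_add a Zero = a" | "sign_add Pos Pos = Pos" | "sign_add Neg Neg = Neg" | "sign_add Pos Neg = Zero" | "sign_add Neg Pos = Zero"

lemma sign_neg_simps [simp]: "sign_neg Pos = Neg" "sign_neg Neg = Pos" "sign_neg Zero = Zero"
  by (simp_all add: sign_neg_def)

text \<open>Sign pairs are signs of (imaginary part, real part); rot multiplies complex numbers, with the
  undetermined sum of opposite signs recorded as Zero.\<close>

fun rot :: "sign \<times> sign \<Rightarrow> sign \<times> sign \<Rightarrow> sign \<times> sign" where
  "rot (l, m) (u, v) = (sign_add (sign_mult l v) (sign_mult m u), sign_add (sign_mult m v) (sign_neg (sign_mult l u)))"

text \<open>Complex conjugation, which inverts numbers of modulus 1; rotation by
  \<open>sconj l\<close> plays the part of division by \<open>l\<close>.\<close>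

fun sconj :: "sign \<times> sign \<Rightarrow> sign \<times> sign" where
  "sconj (l, m) = (sign_neg l, m)"

text \<open>Within the octagon these are the directions of \<open>1\<close>, \<open>i\<close>,
  \<open>-1\<close> and \<open>-i\<close>. Multiplication by them involves no undetermined sum,
  since one summand always vanishes.\<close>

fun axial :: "sign \<times> sign \<Rightarrow> bool" where
  "axial (l, m) \<longleftrightarrow> l = Zero \<or> m = Zero"

definition sign_compat :: "sign \<Rightarrow> sign \<Rightarrow> bool" where
  "sign_compat a b \<longleftrightarrow> a = Zero \<or> b = Zero \<or> a = b"

fun pair_compat :: "sign \<times> sign \<Rightarrow> sign \<times> sign \<Rightarrow> bool" where
  "pair_compat (a, b) (c, d) \<longleftrightarrow> sign_compat a c \<and> sign_compat b d"

text \<open>The sign pattern of z = l w.  For l in an open quadrant bounded by the axial directions a and b,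
  z ranges over the three consecutive cells of the octagon from a w to b w; this choice makes the
  relation convex both in z and in w.\<close>

definition near_rot :: "sign \<times> sign \<Rightarrow> sign \<times> sign \<Rightarrow> sign \<times> sign \<Rightarrow> bool" where
  "near_rot l w z \<longleftrightarrow> pair_compat z (rot l w) \<and> pair_compat w (rot (sconj l) z) \<and> (axial l \<longrightarrow> z = rot l w)"

lemma all_sign: "(\<forall>a. P a) \<longleftrightarrow> P Neg \<and> P Zero \<and> P Pos"
  by (metis sign.exhaust)

lemma axial_iff: "axial l \<longleftrightarrow> fst l = Zero \<or> snd l = Zero"
  by (cases l) simp

text \<open>This supplies the convex part of the fibre over \<open>z\<close>: for \<open>l\<close>
  in an open quadrant it is enough to prescribe the nonzero signs of \<open>rot (sconj l) z\<close>,
  whatever \<open>w\<close> is elsewhere.\<close>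

lemma near_rot_above_sconj: "\<not> axial l \<Longrightarrow> z \<in> octagon \<Longrightarrow> oct_le (rot (sconj l) z) w \<Longrightarrow> near_rot l w z"
proof -
  have "\<forall>l1. l1 \<noteq> Zero \<longrightarrow> (\<forall>l2. l2 \<noteq> Zero \<longrightarrow> (\<forall>x y. x \<noteq> Zero \<or> y \<noteq> Zero \<longrightarrow> (\<forall>u. sg_le (fst (rot (sconj (l1, l2)) (x, y))) u \<longrightarrow>
     (\<forall>v. sg_le (snd (rot (sconj (l1, l2)) (x, y))) v \<longrightarrow> near_rot (l1, l2) (u, v) (x, y)))))"
    by (simp add: all_sign near_rot_def sign_compat_def sg_le_def)
  then show "\<not> axial l \<Longrightarrow> z \<in> octagon \<Longrightarrow> oct_le (rot (sconj l) z) w \<Longrightarrow> near_rot l w z"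
    by (cases l; cases z; cases w) (auto simp: octagon_def)
qed

text \<open>The reason why every element of the fibre can be moved into its convex part: even with a
  smaller direction and a smaller \<open>z\<close>, a related \<open>w\<close> conflicts in no sign
  with the coarse quotient at the top, so composition reaches an element above both.\<close>

lemma near_rot_compat_sconj: "near_rot l' w z \<Longrightarrow> oct_le l' l \<Longrightarrow> l' \<in> octagon \<Longrightarrow> \<not> axial l \<Longrightarrow> z \<in> octagon \<Longrightarrow> oct_le z z0 \<Longrightarrow> pair_compat w (rot (sconj l) z0)"
proof -
  have "\<forall>la. la \<noteq> Zero \<longrightarrow> (\<forall>lb. lb \<noteq> Zero \<longrightarrow> (\<forall>a. sg_le a la \<longrightarrow> (\<forall>b. sg_le b lb \<longrightarrow> a \<noteq> Zero \<or> b \<noteq> Zero \<longrightarrow> 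
     (\<forall>xa x. sg_le x xa \<longrightarrow> (\<forall>ya y. sg_le y ya \<longrightarrow> x \<noteq> Zero \<or> y \<noteq> Zero \<longrightarrow>
     (\<forall>u v. near_rot (a, b) (u, v) (x, y) \<longrightarrow> pair_compat (u, v) (rot (sconj (la, lb)) (xa, ya))))))))"
    by (simp add: all_sign near_rot_def sign_compat_def sg_le_def)
  note this[rule_format, where la = "fst l" and lb = "snd l" and a = "fst l'" and b = "snd l'" and x = "fst z" and y = "snd z"
      and u = "fst w" and v = "snd w" and xa = "fst z0" and ya = "snd z0"]
  then show "near_rot l' w z \<Longrightarrow> oct_le l' l \<Longrightarrow> l' \<in> octagon \<Longrightarrow> \<not> axial l \<Longrightarrow> z \<in> octagon \<Longrightarrow> oct_le z z0 \<Longrightarrow> pair_compat w (rot (sconj l) z0)"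
    by (simp add: prod_le_def octagon_def case_prod_beta axial_iff)
qed

text \<open>This and the next fact mirror the two preceding ones, with \<open>w\<close> fixed and
  \<open>z\<close> varying; they serve the projection to the octagon and \<open>w\<close>.\<close>

lemma near_rot_above: "\<not> axial l \<Longrightarrow> w \<in> octagon \<Longrightarrow> oct_le (rot l w) z \<Longrightarrow> near_rot l w z"
proof -
  have "\<forall>la. la \<noteq> Zero \<longrightarrow> (\<forall>lb. lb \<noteq> Zero \<longrightarrow> (\<forall>x y. x \<noteq> Zero \<or> y \<noteq> Zero \<longrightarrow> (\<forall>u. sg_le (fst (rot (la, lb) (x, y))) u \<longrightarrow>
     (\<forall>v. sg_le (snd (rot (la, lb) (x, y))) v \<longrightarrow> near_rot (la, lb) (x, y) (u, v)))))"
    by (simp add: all_sign near_rot_def sign_compat_def sg_le_def)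
  then show "\<not> axial l \<Longrightarrow> w \<in> octagon \<Longrightarrow> oct_le (rot l w) z \<Longrightarrow> near_rot l w z"
    by (cases l; cases z; cases w) (auto simp: octagon_def)
qed

lemma near_rot_compat: "near_rot l' w z \<Longrightarrow> oct_le l' l \<Longrightarrow> l' \<in> octagon \<Longrightarrow> \<not> axial l \<Longrightarrow> w \<in> octagon \<Longrightarrow> oct_le w w0 \<Longrightarrow> pair_compat z (rot l w0)"
proof -
  have "\<forall>la. la \<noteq> Zero \<longrightarrow> (\<forall>lb. lb \<noteq> Zero \<longrightarrow> (\<forall>a. sg_le a la \<longrightarrow> (\<forall>b. sg_le b lb \<longrightarrow> a \<noteq> Zero \<or> b \<noteq> Zero \<longrightarrow> 
     (\<forall>xa x. sg_le x xa \<longrightarrow> (\<forall>ya y. sg_le y ya \<longrightarrow> x \<noteq> Zero \<or> y \<noteq> Zero \<longrightarrow>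
     (\<forall>u v. near_rot (a, b) (x, y) (u, v) \<longrightarrow> pair_compat (u, v) (rot (la, lb) (xa, ya))))))))"
    by (simp add: all_sign near_rot_def sign_compat_def sg_le_def)
  note this[rule_format, where la = "fst l" and lb = "snd l" and a = "fst l'" and b = "snd l'" and x = "fst w" and y = "snd w"
      and u = "fst z" and v = "snd z" and xa = "fst w0" and ya = "snd w0"]
  then show "near_rot l' w z \<Longrightarrow> oct_le l' l \<Longrightarrow> l' \<in> octagon \<Longrightarrow> \<not> axial l \<Longrightarrow> w \<in> octagon \<Longrightarrow> oct_le w w0 \<Longrightarrow> pair_compat z (rot l w0)"
    by (simp add: prod_le_def octagon_def case_prod_beta axial_iff)
qed

lemma sconj_rot_rot: "axial l \<Longrightarrow> l \<in> octagon \<Longrightarrow> rot (sconj l) (rot l w) = w"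
proof -
  have "\<forall>l1 l2. (l1 = Zero) \<noteq> (l2 = Zero) \<longrightarrow> (\<forall>u v. rot (sconj (l1, l2)) (rot (l1, l2) (u, v)) = (u, v))"
    by (simp add: all_sign)
  then show "axial l \<Longrightarrow> l \<in> octagon \<Longrightarrow> rot (sconj l) (rot l w) = w"
    by (cases l; cases w) (simp only: axial.simps octagon_def mem_Collect_eq prod.case; blast)
qed

lemma rot_axial_mono: "axial l \<Longrightarrow> l \<in> octagon \<Longrightarrow> oct_le w w' \<Longrightarrow> oct_le (rot l w) (rot l w')"
proof -
  have "\<forall>l1 l2. (l1 = Zero) \<noteq> (l2 = Zero) \<longrightarrow> (\<forall>u u'. sg_le u u' \<longrightarrow> (\<forall>v v'. sg_le v v' \<longrightarrow> oct_le (rot (l1, l2) (u, v)) (rot (l1, l2) (u', v'))))"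
    by (simp add: all_sign sg_le_def)
  then show "axial l \<Longrightarrow> l \<in> octagon \<Longrightarrow> oct_le w w' \<Longrightarrow> oct_le (rot l w) (rot l w')"
    by (cases l; cases w; cases w') (simp only: axial.simps octagon_def mem_Collect_eq prod.case prod_le_simp; blast)
qed

text \<open>The convention that opposite signs add to \<open>Zero\<close> never yields zero: for two
  open quadrants exactly one of the two coordinate sums has opposite summands, and the product of
  the four signs decides which.\<close>

lemma rot_octagon: "l \<in> octagon \<Longrightarrow> w \<in> octagon \<Longrightarrow> rot l w \<in> octagon"
proof -
  have "\<forall>a b c d. (a \<noteq> Zero \<or> b \<noteq> Zero) \<longrightarrow> (c \<noteq> Zero \<or> d \<noteq> Zero) \<longrightarrow> fst (rot (a, b) (c, d)) \<noteq> Zero \<or> snd (rot (a, b) (c, d)) \<noteq> Zero"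
    by (simp add: all_sign)
  then show "l \<in> octagon \<Longrightarrow> w \<in> octagon \<Longrightarrow> rot l w \<in> octagon"
    by (cases l; cases w; cases "rot l w") (simp only: octagon_def mem_Collect_eq prod.case, metis fst_conv snd_conv)
qed

text \<open>The product of \<open>l\<close> with its conjugate is a positive real. In an open
  quadrant its imaginary part is a sum of opposite signs, for which the recorded \<open>Zero\<close>
  is the true value; this is what normalises a quotient at \<open>e\<close>.\<close>

lemma rot_unit: "l \<in> octagon \<Longrightarrow> rot (sconj l) l = (Zero, Pos)" "rot l (Zero, Pos) = l"
proof -
  have "\<forall>a b. ((a \<noteq> Zero \<or> b \<noteq> Zero) \<longrightarrow> rot (sconj (a, b)) (a, b) = (Zero, Pos)) \<and> rot (a, b) (Zero, Pos) = (a, b)"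
    by (simp add: all_sign)
  then show "l \<in> octagon \<Longrightarrow> rot (sconj l) l = (Zero, Pos)" "rot l (Zero, Pos) = l"
    by (cases l; simp add: octagon_def)+
qed

lemma pair_compat_refl: "pair_compat a a"
  by (cases a) (simp add: sign_compat_def)

lemma near_rot_rot: "axial l \<Longrightarrow> l \<in> octagon \<Longrightarrow> near_rot l w (rot l w)"
  by (simp add: near_rot_def sconj_rot_rot pair_compat_refl)

lemma sconj_simps [simp]: "sconj (sconj l) = l" "axial (sconj l) = axial l" "sconj l \<in> octagon \<longleftrightarrow> l \<in> octagon"
  by (cases l; cases "fst l"; simp add: octagon_def)+

lemma sign_add_le: "sg_le (sign_add a b) (if a = Zero then b else a)" "sg_le (sign_add a b) (if b = Zero then a else b)"
  by (cases a; cases b; simp add: sg_le_def)+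

section \<open>Contractibility of convex families of covectors\<close>

text \<open>What survives of the covector axioms when signs are prescribed on a subset: the zero
  vector and negatives may be lost, composition and elimination remain.\<close>

definition se_family :: "'e set \<Rightarrow> ('e \<Rightarrow> sign) set \<Rightarrow> bool" where
  "se_family E K \<longleftrightarrow> finite E \<and> (\<forall>X\<in>K. \<forall>f. f \<notin> E \<longrightarrow> X f = Zero) \<and>
     (\<forall>X\<in>K. \<forall>Y\<in>K. sv_comp X Y \<in> K) \<and>
     (\<forall>X\<in>K. \<forall>Y\<in>K. \<forall>f\<in>sv_sep X Y. \<exists>Z\<in>K. Z f = Zero \<and> (\<forall>g. g \<notin> sv_sep X Y \<longrightarrow> Z g = sv_comp X Y g))"

lemma se_family_finite: assumes "se_family E K" shows "finite K"
proof -
  have "finite {X :: 'a \<Rightarrow> sign. \<forall>f. (f \<in> E \<longrightarrow> X f \<in> UNIV) \<and> (f \<notin> E \<longrightarrow> X f = Zero)}"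
    using assms by (intro finite_set_of_finite_funs) (auto simp: se_family_def)
  moreover have "K \<subseteq> {X. \<forall>f. (f \<in> E \<longrightarrow> X f \<in> UNIV) \<and> (f \<notin> E \<longrightarrow> X f = Zero)}"
    using assms by (auto simp: se_family_def)
  ultimately show ?thesis by (rule finite_subset[rotated])
qed

lemma sv_le_iff: "sv_le X Y \<longleftrightarrow> (\<forall>f. sg_le (X f) (Y f))"
  by (simp add: sv_le_def sg_le_def)

lemma sg_le_antisym: "sg_le a b \<Longrightarrow> sg_le b a \<Longrightarrow> a = b"
  by (auto simp: sg_le_def)

lemma sg_le_trans: "sg_le a b \<Longrightarrow> sg_le b c \<Longrightarrow> sg_le a c"
  by (auto simp: sg_le_def)

lemma sg_le_refl [simp]: "sg_le a a"
  by (simp add: sg_le_def)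

lemma finite_poset_sv: "finite K \<Longrightarrow> finite_poset sv_le K"
  unfolding finite_poset_def
proof (intro conjI ballI impI)
  fix X Y Z :: "'a \<Rightarrow> sign"
  show "sv_le X X" by (simp add: sv_le_iff)
  show "X = Y" if "sv_le X Y" "sv_le Y X"
    by (rule ext, rule sg_le_antisym) (use that in \<open>simp_all add: sv_le_iff\<close>)
  show "sv_le X Z" if "sv_le X Y" "sv_le Y Z"
    unfolding sv_le_iff
  proof
    show "sg_le (X f) (Z f)" for f
      by (rule sg_le_trans[of _ "Y f"]) (use that in \<open>simp_all add: sv_le_iff\<close>)
  qed
qed

lemma se_family_comp: "se_family E K \<Longrightarrow> X \<in> K \<Longrightarrow> Y \<in> K \<Longrightarrow> sv_comp X Y \<in> K"
  by (simp add: se_family_def)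

lemma se_family_elim:
  assumes "se_family E K" "X \<in> K" "Y \<in> K" "f \<in> sv_sep X Y"
  obtains Z where "Z \<in> K" "Z f = Zero" "\<And>g. g \<notin> sv_sep X Y \<Longrightarrow> Z g = sv_comp X Y g"
proof -
  have "\<forall>X\<in>K. \<forall>Y\<in>K. \<forall>f\<in>sv_sep X Y. \<exists>Z\<in>K. Z f = Zero \<and> (\<forall>g. g \<notin> sv_sep X Y \<longrightarrow> Z g = sv_comp X Y g)"
    using assms(1) unfolding se_family_def by (elim conjE)
  from this[rule_format, OF assms(2-4)] show ?thesis using that by blast
qed

text \<open>Coordinates on which two members agree never separate them, so elimination leaves the
  prescribed signs untouched.\<close>

lemma se_family_restrict:
  assumes "se_family E K"
  shows "se_family E {X \<in> K. \<forall>f\<in>A. X f = s f}"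
proof -
  have "\<exists>Z\<in>{X \<in> K. \<forall>f\<in>A. X f = s f}. Z f = Zero \<and> (\<forall>g. g \<notin> sv_sep X Y \<longrightarrow> Z g = sv_comp X Y g)"
    if X: "X \<in> K" "\<forall>f\<in>A. X f = s f" and Y: "Y \<in> K" "\<forall>f\<in>A. Y f = s f" and f: "f \<in> sv_sep X Y" for X Y f
  proof -
    obtain Z where Z: "Z \<in> K" "Z f = Zero" "\<And>g. g \<notin> sv_sep X Y \<Longrightarrow> Z g = sv_comp X Y g"
      using se_family_elim[OF assms X(1) Y(1) f] by blast
    have "g \<notin> sv_sep X Y" if "g \<in> A" for g
      using X(2) Y(2) that by (cases "X g") (auto simp: sv_sep_def)
    then have "Z g = s g" if "g \<in> A" for g
      using Z(3) X(2) Y(2) that by (auto simp: sv_comp_def)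
    then show ?thesis using Z by blast
  qed
  moreover have "sv_comp X Y \<in> {X \<in> K. \<forall>f\<in>A. X f = s f}"
    if "X \<in> K" "\<forall>f\<in>A. X f = s f" "Y \<in> K" "\<forall>f\<in>A. Y f = s f" for X Y
    using that se_family_comp[OF assms that(1,3)] by (simp add: sv_comp_def)
  moreover have "finite E" "\<forall>X\<in>K. \<forall>f. f \<notin> E \<longrightarrow> X f = Zero" using assms by (simp_all add: se_family_def)
  ultimately show ?thesis unfolding se_family_def by simp
qed

lemma se_family_above:
  assumes "se_family E K"
  shows "se_family E {X \<in> K. sv_le A X}"
proof -
  have "{X \<in> K. sv_le A X} = {X \<in> K. \<forall>f\<in>{f. A f \<noteq> Zero}. X f = A f}" by (auto simp: sv_le_def)
  then show ?thesis using se_family_restrict[OF assms, of "{f. A f \<noteq> Zero}" A] by simp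
qed

lemma se_family_at: "se_family E K \<Longrightarrow> se_family E {X \<in> K. X g = s}"
  using se_family_restrict[of E K "{g}" "\<lambda>_. s"] by simp

lemma sv_comp_le: "sv_le X (sv_comp X Y)"
  by (simp add: sv_le_def sv_comp_def)

text \<open>Let \<open>g\<close> be a coordinate that is not constant on \<open>K\<close>. In the
  closed half \<open>H s\<close> the members with the sign \<open>s\<close> at \<open>g\<close> are
  cofinal, because composing with \<open>X0\<close> moves upward into them, and they have one
  varying coordinate less. If only one nonzero sign occurs, the closed half is everything. Otherwise
  elimination provides a member vanishing at \<open>g\<close>, so evaluation at \<open>g\<close> has
  nonempty fibres over the sign poset, which is a cone with apex \<open>Zero\<close>.\<close>

lemma contr_poset_se_family:
  assumes "se_family E K" "K \<noteq> {}"
  shows "contr_poset sv_le K"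
  using assms
proof (induction "card {g \<in> E. \<exists>X\<in>K. \<exists>Y\<in>K. X g \<noteq> Y g}" arbitrary: K rule: less_induct)
  case less
  note se = less.prems(1)
  have pK: "finite_poset sv_le K" by (rule finite_poset_sv[OF se_family_finite[OF se]])
  have finE: "finite E" and out: "\<And>X f. X \<in> K \<Longrightarrow> f \<notin> E \<Longrightarrow> X f = Zero"
    and comp: "\<And>X Y. X \<in> K \<Longrightarrow> Y \<in> K \<Longrightarrow> sv_comp X Y \<in> K"
    using se by (auto simp: se_family_def)
  show ?case
  proof (cases "\<exists>g\<in>E. \<exists>X\<in>K. \<exists>Y\<in>K. X g \<noteq> Y g")
    case False
    obtain X where X: "X \<in> K" using less.prems(2) by auto
    have "Y = X" if "Y \<in> K" for Y
      using False X that out by (metis ext)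
    then show ?thesis using X by (intro contr_poset_cone[OF pK X]) (auto simp: sv_le_def)
  next
    case True
    then obtain g where g: "g \<in> E" "\<exists>X\<in>K. \<exists>Y\<in>K. X g \<noteq> Y g" by blast
    have IH: "contr_poset sv_le K'" if "se_family E K'" "K' \<noteq> {}" "K' \<subseteq> K" "\<And>X. X \<in> K' \<Longrightarrow> X g = s" for K' s
    proof (rule less.hyps[OF _ that(1,2)])
      have "g \<notin> {g \<in> E. \<exists>X\<in>K'. \<exists>Y\<in>K'. X g \<noteq> Y g}" using that(4) by auto
      then have "{g \<in> E. \<exists>X\<in>K'. \<exists>Y\<in>K'. X g \<noteq> Y g} \<subset> {g \<in> E. \<exists>X\<in>K. \<exists>Y\<in>K. X g \<noteq> Y g}"
        using g that(3) by blast
      then show "card {g \<in> E. \<exists>X\<in>K'. \<exists>Y\<in>K'. X g \<noteq> Y g} < card {g \<in> E. \<exists>X\<in>K. \<exists>Y\<in>K. X g \<noteq> Y g}"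
        using finE by (intro psubset_card_mono) auto
    qed
    define H where "H s = {X \<in> K. sg_le (X g) s}" for s
    have half: "contr_poset sv_le (H s)" if s: "s \<noteq> Zero" and X0: "X0 \<in> K" "X0 g = s" for s X0
    proof (rule contr_poset_cofinal)
      show "finite_poset sv_le (H s)" by (rule finite_poset_subset[OF pK]) (auto simp: H_def)
      show "{X \<in> K. X g = s} \<subseteq> H s" by (auto simp: H_def sg_le_def)
      show "contr_poset sv_le {X \<in> K. X g = s}" using X0 by (intro IH[OF se_family_at[OF se]]) auto
      show "contr_poset sv_le {Y \<in> {X \<in> K. X g = s}. sv_le X Y}" if "X \<in> H s" for X
      proof (rule IH[OF se_family_above[OF se_family_at[OF se]]])
        have "sv_comp X X0 \<in> {Y \<in> {X \<in> K. X g = s}. sv_le X Y}"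
          using that X0 comp sv_comp_le by (auto simp: H_def sg_le_def sv_comp_def)
        then show "{Y \<in> {X \<in> K. X g = s}. sv_le X Y} \<noteq> {}" by blast
      qed auto
    qed
    obtain s X0 where s: "s \<noteq> Zero" "X0 \<in> K" "X0 g = s" using g(2) by metis
    show ?thesis
    proof (cases "\<exists>X\<in>K. X g = sign_neg s")
      case False
      have "H s = K"
      proof -
        have "sg_le (X g) s" if "X \<in> K" for X
          using False that s(1) by (cases s; cases "X g") (auto simp: sg_le_def)
        then show ?thesis by (auto simp: H_def)
      qed
      then show ?thesis using half[OF s] by simp
    next
      case True
      then obtain X1 where X1: "X1 \<in> K" "X1 g = sign_neg s" by blast
      have "g \<in> sv_sep X0 X1" using s X1 by (simp add: sv_sep_def)
      then obtain Z where Z: "Z \<in> K" "Z g = Zero" using se_family_elim[OF se s(2) X1(1)] by blast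
      have "order_complex sv_le K homotopy_eqv order_complex sg_le UNIV"
      proof (rule quillen_fibre[where f="\<lambda>X. X g", OF pK finite_poset_sg])
        show "sg_le (X g) (Y g)" if "sv_le X Y" for X Y using that by (auto simp: sv_le_def sg_le_def)
        show "contr_poset sv_le {X \<in> K. sg_le (X g) q}" for q
        proof (cases "q = Zero")
          case True
          then show ?thesis using Z by (intro IH[of _ Zero]) (auto simp: sg_le_def intro: se_family_at[OF se])
        next
          case False
          then have "q = s \<or> q = sign_neg s" using s(1) by (cases q; cases s) auto
          then show ?thesis using half[of q X0] half[of q X1] s X1 False unfolding H_def by blast
        qed
      qed auto
      then have "order_complex sg_le UNIV homotopy_eqv order_complex sv_le K" by (subst homotopy_equivalent_space_sym)
      moreover have "contr_poset sg_le UNIV" by (rule contr_poset_cone[OF finite_poset_sg, of Zero]) (auto simp: sg_le_def)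
      ultimately show ?thesis using less.prems(2) by (rule contr_poset_homotopy_eqv)
    qed
  qed
qed

section \<open>Strata of the complexified complement\<close>

lemma oriented_matroid_se: "oriented_matroid E F \<Longrightarrow> se_family E F"
  unfolding oriented_matroid_def se_family_def by simp

lemma om_neg: "oriented_matroid E F \<Longrightarrow> X \<in> F \<Longrightarrow> sv_neg X \<in> F"
  unfolding oriented_matroid_def by simp

definition nonloops :: "('e \<Rightarrow> sign) set \<Rightarrow> 'e set" where
  "nonloops F = {f. \<exists>X\<in>F. X f \<noteq> Zero}"

text \<open>A covector vanishing at a nonloop can be enlarged by composing it with one that does not
  vanish there.\<close>

lemma topes_iff:
  assumes "oriented_matroid E F"
  shows "T \<in> topes F \<longleftrightarrow> T \<in> F \<and> (\<forall>f\<in>nonloops F. T f \<noteq> Zero)"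
proof
  assume T: "T \<in> topes F"
  then have TF: "T \<in> F" and max: "\<And>X. X \<in> F \<Longrightarrow> sv_le T X \<Longrightarrow> X = T" by (auto simp: topes_def)
  have "T f \<noteq> Zero" if f: "f \<in> nonloops F" for f
  proof -
    obtain X where X: "X \<in> F" "X f \<noteq> Zero" using f by (auto simp: nonloops_def)
    have "sv_comp T X = T"
      using max[OF se_family_comp[OF oriented_matroid_se[OF assms] TF X(1)] sv_comp_le] .
    then have "sv_comp T X f = T f" by simp
    then show ?thesis using X(2) by (auto simp: sv_comp_def)
  qed
  then show "T \<in> F \<and> (\<forall>f\<in>nonloops F. T f \<noteq> Zero)" using TF by blast
next
  assume T: "T \<in> F \<and> (\<forall>f\<in>nonloops F. T f \<noteq> Zero)"
  have "X = T" if X: "X \<in> F" "sv_le T X" for X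
  proof
    fix f show "X f = T f"
    proof (cases "T f = Zero")
      case True
      then have "f \<notin> nonloops F" using T by blast
      then show ?thesis using True X(1) by (auto simp: nonloops_def)
    next
      case False
      then show ?thesis using X(2) by (auto simp: sv_le_def)
    qed
  qed
  then show "T \<in> topes F" using T by (simp add: topes_def)
qed

lemma finite_salvetti: "oriented_matroid E F \<Longrightarrow> finite (salvetti F)"
  using se_family_finite[OF oriented_matroid_se, of E F]
  by (rule_tac finite_subset[of _ "F \<times> F"]) (auto simp: salvetti_def topes_def)

lemma sv_comp_absorb: "sv_le X Y \<Longrightarrow> sv_comp Y (sv_comp X Z) = sv_comp Y Z"
  by (auto simp: sv_comp_def sv_le_def fun_eq_iff)

lemma finite_poset_salvetti:
  assumes "oriented_matroid E F"
  shows "finite_poset salvetti_le (salvetti F)"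
  unfolding finite_poset_def
proof (intro conjI ballI impI)
  have sv: "finite_poset sv_le F" by (rule finite_poset_sv[OF se_family_finite[OF oriented_matroid_se[OF assms]]])
  show "finite (salvetti F)" by (rule finite_salvetti[OF assms])
  fix p q r :: "('a \<Rightarrow> sign) \<times> ('a \<Rightarrow> sign)"
  assume p: "p \<in> salvetti F"
  then have pF: "fst p \<in> F" "sv_comp (fst p) (snd p) = snd p" by (auto simp: salvetti_def)
  show "salvetti_le p p" using pF(2) by (simp add: salvetti_le_def sv_le_iff)
  assume q: "q \<in> salvetti F"
  then have qF: "fst q \<in> F" "sv_comp (fst q) (snd q) = snd q" by (auto simp: salvetti_def)
  show "p = q" if "salvetti_le p q" "salvetti_le q p"
  proof -
    have "fst p = fst q"
      using sv pF(1) qF(1) that unfolding finite_poset_def salvetti_le_def by blast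
    then show ?thesis using that qF(2) by (simp add: salvetti_le_def prod_eq_iff)
  qed
  show "salvetti_le p r" if "salvetti_le p q" "salvetti_le q r"
  proof -
    have 1: "sv_le (fst q) (fst p)" "sv_le (fst r) (fst q)" using that by (auto simp: salvetti_le_def)
    have "sv_le (fst r) (fst p)"
      unfolding sv_le_iff
    proof
      fix f show "sg_le (fst r f) (fst p f)"
        by (rule sg_le_trans[of _ "fst q f"]) (use 1 in \<open>simp_all add: sv_le_iff\<close>)
    qed
    moreover have "sv_comp (fst p) (snd r) = snd p"
      using that sv_comp_absorb[OF 1(1), of "snd r"] by (simp add: salvetti_le_def)
    ultimately show ?thesis by (simp add: salvetti_le_def)
  qed
qed

text \<open>Pairs (imaginary part, real part) of covectors without common zero: the strata of the
  complement of the complexified arrangement.  The set B is either empty or the singleton of the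
  element of the decone, whose coordinate is then normalised to 1.\<close>

definition strata :: "('e \<Rightarrow> sign) set \<Rightarrow> 'e set \<Rightarrow> (('e \<Rightarrow> sign) \<times> ('e \<Rightarrow> sign)) set" where
  "strata F B = {(X, Y). X \<in> F \<and> Y \<in> F \<and> (\<forall>f\<in>nonloops F. X f \<noteq> Zero \<or> Y f \<noteq> Zero) \<and>
     (\<forall>f\<in>B. X f = Zero \<and> Y f = Pos)}"

abbreviation strata_le :: "('e \<Rightarrow> sign) \<times> ('e \<Rightarrow> sign) \<Rightarrow> ('e \<Rightarrow> sign) \<times> ('e \<Rightarrow> sign) \<Rightarrow> bool" where
  "strata_le \<equiv> prod_le sv_le sv_le"

lemma finite_poset_strata: "oriented_matroid E F \<Longrightarrow> finite_poset strata_le (strata F B)"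
  by (rule finite_poset_subset[OF finite_poset_prod[OF finite_poset_sv finite_poset_sv], of F F])
     (auto intro: se_family_finite oriented_matroid_se simp: strata_def)

lemma contr_poset_Times_se:
  assumes "se_family E K" "K \<noteq> {}" "se_family E K'" "K' \<noteq> {}"
  shows "contr_poset strata_le (K \<times> K')"
  using assms by (intro contr_poset_prod contr_poset_se_family finite_poset_sv se_family_finite)

lemma contr_poset_strata_family:
  assumes "se_family E K" "K \<noteq> {}"
  shows "contr_poset strata_le ((\<lambda>X. (X, Y)) ` K)"
  using contr_poset_se_family[OF assms] by (rule contr_poset_image[rotated 2]) (auto intro: inj_onI simp: sv_le_iff)

text \<open>Larger real parts are lower in the Salvetti order, so the map is antitone and the fibre
  lemma is applied to the dual. The parameter \<open>B\<close> lets one argument treat both the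
  Salvetti poset and its deconed version.\<close>

lemma strata_salvetti:
  assumes om: "oriented_matroid E F" and B: "B \<subseteq> {e}"
  shows "order_complex strata_le (strata F B) homotopy_eqv order_complex salvetti_le {(Y, C) \<in> salvetti F. \<forall>f\<in>B. Y f = Pos}"
proof -
  note se = oriented_matroid_se[OF om]
  define S where "S = {(Y, C) \<in> salvetti F. \<forall>f\<in>B. Y f = Pos}"
  define h where "h = (\<lambda>(X :: 'a \<Rightarrow> sign, Y). (Y, sv_comp Y X))"
  have pS: "finite_poset salvetti_le S" by (rule finite_poset_subset[OF finite_poset_salvetti[OF om]]) (auto simp: S_def)
  have loop: "X f = Zero" if "X \<in> F" "f \<notin> nonloops F" for X f using that by (auto simp: nonloops_def)
  have "order_complex strata_le (strata F B) homotopy_eqv order_complex (\<lambda>p q. salvetti_le q p) S"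
  proof (rule quillen_fibre[where f=h, OF finite_poset_strata[OF om] finite_poset_dual[OF pS]])
    show "h z \<in> S" if "z \<in> strata F B" for z
      using that se_family_comp[OF se]
      by (auto simp: h_def S_def strata_def salvetti_def topes_iff[OF om] sv_comp_absorb[OF _] sv_comp_def fun_eq_iff split: if_splits)
    show "salvetti_le (h z') (h z)" if z: "z \<in> strata F B" "z' \<in> strata F B" "strata_le z z'" for z z'
    proof -
      obtain X Y X' Y' where zz: "z = (X, Y)" "z' = (X', Y')" by (cases z; cases z')
      have le: "sv_le X X'" "sv_le Y Y'" using z by (simp_all add: zz)
      have XY: "X' \<in> F" "\<forall>f\<in>nonloops F. X f \<noteq> Zero \<or> Y f \<noteq> Zero" using z by (auto simp: zz strata_def)
      have "sv_comp Y' (sv_comp Y X) f = sv_comp Y' X' f" for f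
        using le loop[OF XY(1), of f] XY(2) by (cases "f \<in> nonloops F") (auto simp: sv_comp_def sv_le_def)
      then show ?thesis using le by (simp add: zz h_def salvetti_le_def fun_eq_iff)
    qed
    fix q assume q: "q \<in> S"
    obtain F0 C0 where q': "q = (F0, C0)" by (cases q)
    have F0: "F0 \<in> F" "C0 \<in> F" "sv_comp F0 C0 = C0" "\<forall>f\<in>nonloops F. C0 f \<noteq> Zero" "\<forall>f\<in>B. F0 f = Pos"
      using q by (auto simp: q' S_def salvetti_def topes_iff[OF om])
    define K where "K = {X \<in> {X \<in> F. \<forall>f\<in>B. X f = Zero}. \<forall>f\<in>{f. F0 f = Zero}. X f = C0 f}"
    have K: "se_family E K"
      unfolding K_def by (intro se_family_restrict se_family_restrict[where s="\<lambda>_. Zero"] se)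
    have KC: "sv_comp F0 X = C0 \<longleftrightarrow> (\<forall>f\<in>{f. F0 f = Zero}. X f = C0 f)" for X
    proof -
      have "C0 f = F0 f" if "F0 f \<noteq> Zero" for f
        using fun_cong[OF F0(3), of f] that by (simp add: sv_comp_def)
      then show ?thesis by (auto simp: sv_comp_def fun_eq_iff)
    qed
    have Kne: "K \<noteq> {}"
    proof (cases "B = {}")
      case True
      then have "C0 \<in> K" using F0 by (auto simp: K_def)
      then show ?thesis by blast
    next
      case False
      then have Be: "B = {e}" using B by auto
      \<comment> \<open>The witness imitates \<open>C0 - t F0\<close> with \<open>t\<close> chosen
        to reach zero at \<open>e\<close>: eliminate \<open>e\<close> between \<open>C0\<close> and
        the negative of \<open>F0\<close>. On the zeros of \<open>F0\<close> nothing separates the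
        two and the result keeps the signs of \<open>C0\<close>.\<close>
      have "C0 e = Pos" using F0(3,5) unfolding Be by (metis insertI1 sign.distinct(5) sv_comp_def)
      then have "e \<in> sv_sep C0 (sv_neg F0)" using F0(5) by (simp add: sv_sep_def sv_neg_def Be)
      then obtain Z where Z: "Z \<in> F" "Z e = Zero" "\<And>g. g \<notin> sv_sep C0 (sv_neg F0) \<Longrightarrow> Z g = sv_comp C0 (sv_neg F0) g"
        using se_family_elim[OF se F0(2) om_neg[OF om F0(1)]] by blast
      have "Z f = C0 f" if "F0 f = Zero" for f
      proof -
        have "f \<notin> sv_sep C0 (sv_neg F0)" using that by (cases "C0 f") (auto simp: sv_sep_def sv_neg_def)
        then show ?thesis using Z(3)[of f] that by (simp add: sv_comp_def sv_neg_def)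
      qed
      then have "Z \<in> K" using Z by (auto simp: K_def Be)
      then show ?thesis by blast
    qed
    define A where "A = (\<lambda>X. (X, F0)) ` K"
    \<comment> \<open>For \<open>Y \<le> F0\<close> the composition of \<open>F0\<close> with
      \<open>Y \<circ> X\<close> is that of \<open>F0\<close> with \<open>X\<close>. So
      \<open>Y\<close> is constrained only by \<open>Y \<le> F0\<close> and can be raised to
      \<open>F0\<close>, which makes \<open>A\<close> cofinal.\<close>
    have "{z \<in> strata F B. salvetti_le q (h z)} = {(X, Y) \<in> strata F B. sv_le Y F0 \<and> sv_comp F0 X = C0}"
      by (auto simp: q' h_def salvetti_le_def sv_comp_absorb)
    moreover have "contr_poset strata_le {(X, Y) \<in> strata F B. sv_le Y F0 \<and> sv_comp F0 X = C0}"
    proof (rule contr_poset_cofinal)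
      show ps: "finite_poset strata_le {(X, Y) \<in> strata F B. sv_le Y F0 \<and> sv_comp F0 X = C0}"
        by (rule finite_poset_subset[OF finite_poset_strata[OF om]]) auto
      show AS: "A \<subseteq> {(X, Y) \<in> strata F B. sv_le Y F0 \<and> sv_comp F0 X = C0}"
      proof -
        have "(X, F0) \<in> strata F B \<and> sv_comp F0 X = C0" if "X \<in> K" for X
        proof -
          have c: "sv_comp F0 X = C0" using that unfolding KC by (simp add: K_def)
          have "X f \<noteq> Zero \<or> F0 f \<noteq> Zero" if "f \<in> nonloops F" for f
            using fun_cong[OF c, of f] F0(4) that by (auto simp: sv_comp_def)
          then show ?thesis using that c F0 by (auto simp: strata_def K_def)
        qed
        then show ?thesis by (auto simp: A_def sv_le_iff)
      qed
      show "contr_poset strata_le A" unfolding A_def by (rule contr_poset_strata_family[OF K Kne])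
      show "contr_poset strata_le {y \<in> A. strata_le z y}"
        if z: "z \<in> {(X, Y) \<in> strata F B. sv_le Y F0 \<and> sv_comp F0 X = C0}" for z
      proof -
        obtain X Y where zz: "z = (X, Y)" by (cases z)
        have XY: "X \<in> F" "\<forall>f\<in>B. X f = Zero" "sv_le Y F0" "sv_comp F0 X = C0" using z by (auto simp: zz strata_def)
        then have "X \<in> K" using KC by (auto simp: K_def)
        show ?thesis
        proof (rule contr_poset_cone)
          show "finite_poset strata_le {y \<in> A. strata_le z y}" by (rule finite_poset_subset[OF ps]) (use AS in auto)
          show "(X, F0) \<in> {y \<in> A. strata_le z y}" using \<open>X \<in> K\<close> XY(3) by (auto simp: A_def zz sv_le_iff)
          show "strata_le (X, F0) y \<or> strata_le y (X, F0)" if "y \<in> {y \<in> A. strata_le z y}" for y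
            using that by (auto simp: A_def zz sv_le_iff)
        qed
      qed
    qed
    ultimately show "contr_poset strata_le {z \<in> strata F B. salvetti_le q (h z)}" by simp
  qed
  then show ?thesis unfolding S_def[symmetric] order_complex_dual[of salvetti_le] .
qed

section \<open>The circle action\<close>

lemma rot_sconj_rot: "axial l \<Longrightarrow> l \<in> octagon \<Longrightarrow> rot l (rot (sconj l) w) = w"
  using sconj_rot_rot[of "sconj l" w] by simp

lemma oct_le_axial: "oct_le l' l \<Longrightarrow> l' \<in> octagon \<Longrightarrow> axial l \<Longrightarrow> l' = l"
  by (cases l; cases l') (auto simp: sg_le_def octagon_def)

lemma sign_add_Zero [simp]: "sign_add a Zero = a"
  by (cases a) auto

lemma sign_mult_Zero [simp]: "sign_mult a Zero = Zero"
  by (cases a) auto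

lemma sign_mult_neg [simp]: "sign_mult (sign_neg a) b = sign_neg (sign_mult a b)"
  by (cases a; cases b; simp)

section \<open>Multiplying pairs of sign vectors by directions\<close>

definition sv_mult :: "sign \<Rightarrow> ('e \<Rightarrow> sign) \<Rightarrow> ('e \<Rightarrow> sign)" where
  "sv_mult s X = (\<lambda>f. sign_mult s (X f))"

lemma sv_mult_mem:
  assumes "oriented_matroid E F" "X \<in> F" "s \<noteq> Zero"
  shows "sv_mult s X \<in> F"
proof -
  have "sv_mult Pos X = X" "sv_mult Neg X = sv_neg X" by (simp_all add: sv_mult_def sv_neg_def)
  then show ?thesis using assms om_neg[OF assms(1,2)] by (cases s) auto
qed

definition coord :: "('e \<Rightarrow> sign) \<times> ('e \<Rightarrow> sign) \<Rightarrow> 'e \<Rightarrow> sign \<times> sign" where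
  "coord w f = (fst w f, snd w f)"

definition rotv :: "sign \<times> sign \<Rightarrow> ('e \<Rightarrow> sign) \<times> ('e \<Rightarrow> sign) \<Rightarrow> ('e \<Rightarrow> sign) \<times> ('e \<Rightarrow> sign)" where
  "rotv l w = (\<lambda>f. fst (rot l (coord w f)), \<lambda>f. snd (rot l (coord w f)))"

lemma coord_rotv [simp]: "coord (rotv l w) f = rot l (coord w f)"
  by (simp add: coord_def rotv_def)

lemma strata_le_iff: "strata_le w w' \<longleftrightarrow> (\<forall>f. oct_le (coord w f) (coord w' f))"
  by (auto simp: prod_le_def sv_le_iff coord_def)

lemma strata_iff: "w \<in> strata F B \<longleftrightarrow> fst w \<in> F \<and> snd w \<in> F \<and> (\<forall>f\<in>nonloops F. coord w f \<in> octagon) \<and> (\<forall>f\<in>B. coord w f = (Zero, Pos))"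
  by (cases w) (auto simp: strata_def coord_def octagon_def)

text \<open>Such a rotation at most exchanges the real and the imaginary part and changes their
  signs.\<close>

lemma rotv_axial_mem:
  assumes om: "oriented_matroid E F" and w: "fst w \<in> F" "snd w \<in> F" and l: "axial l" "l \<in> octagon"
  shows "fst (rotv l w) \<in> F" "snd (rotv l w) \<in> F"
proof -
  obtain a b where ab: "l = (a, b)" by (cases l)
  have "a = Zero \<and> b \<noteq> Zero \<or> a \<noteq> Zero \<and> b = Zero" using l by (auto simp: ab octagon_def)
  then have "fst (rotv l w) \<in> F \<and> snd (rotv l w) \<in> F"
  proof
    assume *: "a = Zero \<and> b \<noteq> Zero"
    then have "rotv l w = (sv_mult b (fst w), sv_mult b (snd w))"
      by (simp add: rotv_def ab sv_mult_def coord_def)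
    then show ?thesis using * sv_mult_mem[OF om] w by simp
  next
    assume *: "a \<noteq> Zero \<and> b = Zero"
    then have "rotv l w = (sv_mult a (snd w), sv_mult (sign_neg a) (fst w))"
      by (simp add: rotv_def ab sv_mult_def coord_def)
    moreover have "sign_neg a \<noteq> Zero" using * by (cases a) auto
    ultimately show ?thesis using * sv_mult_mem[OF om] w by simp
  qed
  then show "fst (rotv l w) \<in> F" "snd (rotv l w) \<in> F" by auto
qed

text \<open>A coordinatewise sum of covectors need not be a covector, but their composition is one
  and lies above the sum.\<close>

lemma rotv_upper_bounds:
  assumes om: "oriented_matroid E F" and w: "fst w \<in> F" "snd w \<in> F" and l: "\<not> axial l"
  obtains X Y where "X \<in> F" "Y \<in> F" "sv_le (fst (rotv l w)) X" "sv_le (snd (rotv l w)) Y"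
proof -
  obtain a b where ab: "l = (a, b)" by (cases l)
  have nz: "a \<noteq> Zero" "b \<noteq> Zero" "sign_neg a \<noteq> Zero" using l by (auto simp: ab) (cases a; simp)
  note se = oriented_matroid_se[OF om]
  have "sv_le (fst (rotv l w)) (sv_comp (sv_mult a (snd w)) (sv_mult b (fst w)))"
    unfolding sv_le_iff using sign_add_le(1) by (auto simp: rotv_def ab sv_comp_def sv_mult_def coord_def)
  moreover have "sv_le (snd (rotv l w)) (sv_comp (sv_mult b (snd w)) (sv_mult (sign_neg a) (fst w)))"
    unfolding sv_le_iff using sign_add_le(1) by (auto simp: rotv_def ab sv_comp_def sv_mult_def coord_def)
  ultimately show ?thesis
    by (rule that[rotated 2]) (intro se_family_comp[OF se] sv_mult_mem[OF om] w nz)+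
qed

text \<open>A sign of \<open>a\<close> could be lost only where \<open>U\<close> has the opposite
  sign. This is how an element \<open>U\<close> of a fibre climbs into the family above
  \<open>a\<close>.\<close>

lemma sv_le_comp_compat:
  assumes "\<And>f. sign_compat (U f) (a f)" "sv_le a V"
  shows "sv_le a (sv_comp U V)"
  unfolding sv_le_iff
proof
  fix f
  have "sg_le (a f) (V f)" using assms(2) by (simp add: sv_le_iff)
  then show "sg_le (a f) (sv_comp U V f)" using assms(1)[of f] by (auto simp: sg_le_def sign_compat_def sv_comp_def)
qed

lemma contr_poset_pair_right: "contr_poset le P \<Longrightarrow> le' x x \<Longrightarrow> contr_poset (prod_le le' le) ({x} \<times> P)"
proof -
  assume "contr_poset le P" "le' x x"
  then have "contr_poset (prod_le le' le) (Pair x ` P)" by (intro contr_poset_image) (auto simp: inj_on_def)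
  moreover have "Pair x ` P = {x} \<times> P" by auto
  ultimately show ?thesis by simp
qed

text \<open>Pairs (z, w) where w is normalised at e and z is, up to near_rot, the multiple of w by the
  complex number z(e).\<close>

definition twisted :: "('e \<Rightarrow> sign) set \<Rightarrow> 'e \<Rightarrow> ((('e \<Rightarrow> sign) \<times> ('e \<Rightarrow> sign)) \<times> (('e \<Rightarrow> sign) \<times> ('e \<Rightarrow> sign))) set" where
  "twisted F e = {(z, w). z \<in> strata F {} \<and> w \<in> strata F {e} \<and> (\<forall>f. near_rot (coord z e) (coord w f) (coord z f))}"

abbreviation twisted_le where "twisted_le \<equiv> prod_le strata_le strata_le"

lemma finite_poset_twisted:
  assumes "oriented_matroid E F"
  shows "finite_poset twisted_le (twisted F e)"
  by (rule finite_poset_subset[OF finite_poset_prod[OF finite_poset_strata[OF assms] finite_poset_strata[OF assms]], of _ "{}" "{e}"])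
     (auto simp: twisted_def)

lemma strata_off:
  assumes "z \<in> strata F B" "f \<notin> nonloops F"
  shows "coord z f = (Zero, Zero)"
  using assms by (auto simp: strata_iff nonloops_def coord_def)

lemma near_rot_Zero [simp]: "near_rot l (Zero, Zero) (Zero, Zero)"
  by (cases l) (simp add: near_rot_def sign_compat_def)

text \<open>Let \<open>l\<close> be the value of \<open>z0\<close> at \<open>e\<close>. If
  \<open>l\<close> is axial, it is minimal in the octagon, so every \<open>z\<close> in the fibre
  has this value and determines its \<open>w\<close>; the fibre has the greatest element
  \<open>(z0, w0)\<close>. If \<open>l\<close> is open, the pairs \<open>(z0, w)\<close> with
  \<open>w\<close> above \<open>w0\<close> and normalised at \<open>e\<close> are cofinal, and their
  signs are prescribed separately in the two components of \<open>w\<close>.\<close>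

lemma twisted_strata:
  assumes om: "oriented_matroid E F" and e: "e \<in> nonloops F"
  shows "order_complex twisted_le (twisted F e) homotopy_eqv order_complex strata_le (strata F {})"
proof (rule quillen_fibre[where f=fst, OF finite_poset_twisted[OF om] finite_poset_strata[OF om]])
  note se = oriented_matroid_se[OF om]
  show "fst p \<in> strata F {}" if "p \<in> twisted F e" for p using that by (auto simp: twisted_def)
  show "strata_le (fst p) (fst q)" if "twisted_le p q" for p q using that by (simp add: prod_le_def)
  fix z0 assume z0: "z0 \<in> strata F {}"
  define l where "l = coord z0 e"
  have lo: "l \<in> octagon" using z0 e by (simp add: l_def strata_iff)
  define S where "S = {p \<in> twisted F e. strata_le (fst p) z0}"
  have pS: "finite_poset twisted_le S" by (rule finite_poset_subset[OF finite_poset_twisted[OF om]]) (auto simp: S_def)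
  have z0F: "fst z0 \<in> F" "snd z0 \<in> F" using z0 by (auto simp: strata_iff)
  have refl: "strata_le z z" for z :: "('a \<Rightarrow> sign) \<times> ('a \<Rightarrow> sign)" by (simp add: prod_le_def sv_le_iff)
  define w0 where "w0 = rotv (sconj l) z0"
  have w0e: "coord w0 e = (Zero, Pos)" by (simp add: w0_def l_def[symmetric] rot_unit lo)
  have w0o: "coord w0 f \<in> octagon" if "f \<in> nonloops F" for f
    using z0 that lo by (simp add: w0_def rot_octagon strata_iff)
  show "contr_poset twisted_le {p \<in> twisted F e. strata_le (fst p) z0}"
  proof (cases "axial l")
    case True
    have w0: "w0 \<in> strata F {e}"
      using w0e w0o rotv_axial_mem[OF om z0F, of "sconj l"] True lo by (simp add: strata_iff w0_def)
    have "near_rot l (coord w0 f) (coord z0 f)" for f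
      using near_rot_rot[OF True lo, of "coord w0 f"] by (simp add: w0_def rot_sconj_rot True lo)
    then have "(z0, w0) \<in> S" using z0 w0 refl by (simp add: S_def twisted_def l_def[symmetric])
    moreover have "twisted_le p (z0, w0)" if p: "p \<in> S" for p
    proof -
      obtain z w where zw: "p = (z, w)" by (cases p)
      have z: "z \<in> strata F {}" "strata_le z z0" "\<And>f. near_rot (coord z e) (coord w f) (coord z f)"
        using p by (auto simp: S_def twisted_def zw)
      have "coord z e = l"
        using z e True by (intro oct_le_axial) (auto simp: strata_le_iff strata_iff l_def)
      then have "coord z f = rot l (coord w f)" for f using z(3)[of f] True by (simp add: near_rot_def)
      then have "coord w f = rot (sconj l) (coord z f)" for f by (simp add: sconj_rot_rot True lo)
      then have "strata_le w w0"
        using z(2) True lo by (simp add: strata_le_iff w0_def rot_axial_mono)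
      then show ?thesis using z(2) by (simp add: zw)
    qed
    ultimately show ?thesis unfolding S_def[symmetric] by (intro contr_poset_cone[OF pS]) auto
  next
    case False
    define KU where "KU = {U \<in> {U \<in> F. U e = Zero}. sv_le (fst w0) U}"
    define KV where "KV = {V \<in> F. sv_le (snd w0) V}"
    have seU: "se_family E KU" unfolding KU_def by (intro se_family_above se_family_at se)
    have seV: "se_family E KV" unfolding KV_def by (intro se_family_above se)
    have neV: "KV \<noteq> {}"
      using rotv_upper_bounds[OF om z0F, of "sconj l"] False by (auto simp: KV_def w0_def)
    \<comment> \<open>A plain composition \<open>A \<circ> B\<close> would lie above the imaginary
      part of \<open>w0\<close> but not vanish at \<open>e\<close>. There the summands
      \<open>A\<close> and \<open>B\<close> oppose each other, so \<open>e\<close> can be eliminated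
      between them; the elimination may change only coordinates where \<open>A\<close> and
      \<open>B\<close> are opposite, and there \<open>w0\<close> is \<open>Zero\<close>.\<close>
    have neU: "KU \<noteq> {}"
    proof -
      obtain a b where ab: "l = (a, b)" by (cases l)
      have nz: "a \<noteq> Zero" "b \<noteq> Zero" "sign_neg a \<noteq> Zero" using False by (auto simp: ab) (cases a; simp)
      define A B where "A = sv_mult (sign_neg a) (snd z0)" and "B = sv_mult b (fst z0)"
      have AB: "A \<in> F" "B \<in> F" using sv_mult_mem[OF om] z0F nz by (auto simp: A_def B_def)
      have z0e: "fst z0 e = a" "snd z0 e = b" using ab by (auto simp: l_def coord_def)
      have "e \<in> sv_sep A B"
        using nz by (cases a; cases b) (auto simp: sv_sep_def A_def B_def sv_mult_def z0e)
      then obtain Z where Z: "Z \<in> F" "Z e = Zero" "\<And>g. g \<notin> sv_sep A B \<Longrightarrow> Z g = sv_comp A B g"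
        using se_family_elim[OF se AB] by blast
      have "sg_le (fst w0 f) (Z f)" for f
      proof -
        have w: "fst w0 f = sign_add (A f) (B f)" by (simp add: w0_def rotv_def ab coord_def A_def B_def sv_mult_def)
        show ?thesis
        proof (cases "f \<in> sv_sep A B")
          case True
          then have "fst w0 f = Zero" unfolding w by (cases "A f") (auto simp: sv_sep_def)
          then show ?thesis by (simp add: sg_le_def)
        next
          case False
          then show ?thesis using Z(3)[OF False] sign_add_le(1)[of "A f" "B f"] by (simp add: w sv_comp_def)
        qed
      qed
      then have "Z \<in> KU" using Z by (simp add: KU_def sv_le_iff)
      then show ?thesis by blast
    qed
    have mem: "(z0, w) \<in> S" if w: "w \<in> KU \<times> KV" for w
    proof -
      have wF: "fst w \<in> F" "snd w \<in> F" "fst w e = Zero" "strata_le w0 w"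
        using w by (auto simp: KU_def KV_def prod_le_def)
      then have le: "oct_le (coord w0 f) (coord w f)" for f by (simp add: strata_le_iff)
      have "coord w e = (Zero, Pos)" using le[of e] wF(3) unfolding w0e by (simp add: coord_def sg_le_def)
      moreover have "coord w f \<in> octagon" if "f \<in> nonloops F" for f
        using le[of f] w0o[OF that] by (auto simp: octagon_def coord_def sg_le_def)
      ultimately have "w \<in> strata F {e}" using wF by (simp add: strata_iff)
      moreover have "near_rot l (coord w f) (coord z0 f)" for f
      proof (cases "f \<in> nonloops F")
        case True
        then show ?thesis using z0 le[of f] by (intro near_rot_above_sconj[OF False]) (auto simp: strata_iff w0_def)
      next
        case f: False
        then show ?thesis using strata_off[OF z0 f] strata_off[OF \<open>w \<in> strata F {e}\<close> f] by simp
      qed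
      ultimately show ?thesis using z0 refl by (simp add: S_def twisted_def l_def[symmetric])
    qed
    have "contr_poset twisted_le S"
    proof (rule contr_poset_cofinal[OF pS])
      show "{z0} \<times> (KU \<times> KV) \<subseteq> S" using mem by auto
      show "contr_poset twisted_le ({z0} \<times> (KU \<times> KV))"
        by (rule contr_poset_pair_right[where le'=strata_le, OF contr_poset_Times_se[OF seU neU seV neV] refl])
      fix p assume p: "p \<in> S"
      obtain z w where zw: "p = (z, w)" by (cases p)
      have z: "z \<in> strata F {}" "strata_le z z0" "w \<in> strata F {e}" "\<And>f. near_rot (coord z e) (coord w f) (coord z f)"
        using p by (auto simp: S_def twisted_def zw)
      \<comment> \<open>Here \<open>z\<close> and its value at \<open>e\<close> may lie strictly
        below \<open>z0\<close> and \<open>l\<close>. Compatibility with \<open>w0\<close> survives,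
        so composing \<open>w\<close> with \<open>U0\<close> and \<open>V0\<close> gives members of
        \<open>KU\<close> and \<open>KV\<close> above \<open>w\<close>.\<close>
      have cp: "pair_compat (coord w f) (coord w0 f)" for f
      proof (cases "f \<in> nonloops F")
        case True
        have "oct_le (coord z e) l" "oct_le (coord z f) (coord z0 f)" using z(2) by (simp_all add: strata_le_iff l_def)
        moreover have "coord z e \<in> octagon" "coord z f \<in> octagon" using z(1) e True by (simp_all add: strata_iff)
        ultimately show ?thesis unfolding w0_def coord_rotv using near_rot_compat_sconj[OF z(4)] False by blast
      next
        case f: False
        then show ?thesis using strata_off[OF z(3) f] by (cases "coord w0 f") (simp add: sign_compat_def)
      qed
      define KU' where "KU' = {U \<in> KU. sv_le (fst w) U}"
      define KV' where "KV' = {V \<in> KV. sv_le (snd w) V}"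
      have wF: "fst w \<in> F" "snd w \<in> F" "fst w e = Zero" using z(3) by (auto simp: strata_iff coord_def)
      obtain U0 V0 where UV: "U0 \<in> KU" "V0 \<in> KV" using neU neV by blast
      have "sv_comp (fst w) U0 \<in> KU'"
      proof -
        have "sv_le (fst w0) (sv_comp (fst w) U0)"
          using UV(1) cp by (intro sv_le_comp_compat) (auto simp: KU_def coord_def)
        moreover have "sv_comp (fst w) U0 \<in> F" using UV(1) wF se_family_comp[OF se] by (simp add: KU_def)
        moreover have "sv_comp (fst w) U0 e = Zero" using UV(1) wF by (simp add: KU_def sv_comp_def)
        ultimately show ?thesis by (simp add: KU'_def KU_def sv_comp_le)
      qed
      moreover have "sv_comp (snd w) V0 \<in> KV'"
      proof -
        have "sv_le (snd w0) (sv_comp (snd w) V0)"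
          using UV(2) cp by (intro sv_le_comp_compat) (auto simp: KV_def coord_def)
        moreover have "sv_comp (snd w) V0 \<in> F" using UV(2) wF se_family_comp[OF se] by (simp add: KV_def)
        ultimately show ?thesis by (simp add: KV'_def KV_def sv_comp_le)
      qed
      ultimately have ne: "KU' \<noteq> {}" "KV' \<noteq> {}" by blast+
      have "{y \<in> {z0} \<times> (KU \<times> KV). twisted_le p y} = {z0} \<times> (KU' \<times> KV')"
        using z(2) by (auto simp: zw KU'_def KV'_def prod_le_def)
      moreover have "contr_poset twisted_le ({z0} \<times> (KU' \<times> KV'))"
        by (rule contr_poset_pair_right[where le'=strata_le, OF contr_poset_Times_se[OF _ ne(1) _ ne(2)] refl])
           (unfold KU'_def KV'_def, (rule se_family_above[OF seU] se_family_above[OF seV])+)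
      ultimately show "contr_poset twisted_le {y \<in> {z0} \<times> (KU \<times> KV). twisted_le p y}" by simp
    qed
    then show ?thesis by (simp add: S_def)
  qed
qed

lemma contr_poset_pair_left: "contr_poset le P \<Longrightarrow> le' x x \<Longrightarrow> contr_poset (prod_le le le') (P \<times> {x})"
proof -
  assume "contr_poset le P" "le' x x"
  then have "contr_poset (prod_le le le') ((\<lambda>p. (p, x)) ` P)" by (intro contr_poset_image) (auto simp: inj_on_def)
  moreover have "(\<lambda>p. (p, x)) ` P = P \<times> {x}" by auto
  ultimately show ?thesis by simp
qed

text \<open>Now \<open>z\<close> varies below a fixed direction \<open>l\<close> and a fixed
  \<open>w0\<close>. As \<open>w0\<close> is \<open>1\<close> at \<open>e\<close>, the coarse
  product \<open>z0\<close> has the value \<open>l\<close> there. For axial \<open>l\<close> the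
  pair \<open>(z0, w0)\<close> is greatest; for open \<open>l\<close> all \<open>z\<close> above
  \<open>z0\<close> form the cofinal family, and compositions suffice to find them.\<close>

lemma twisted_octagon:
  assumes om: "oriented_matroid E F" and e: "e \<in> nonloops F"
  shows "order_complex twisted_le (twisted F e) homotopy_eqv order_complex (prod_le oct_le strata_le) (octagon \<times> strata F {e})"
proof (rule quillen_fibre[where f="\<lambda>p. (coord (fst p) e, snd p)", OF finite_poset_twisted[OF om] finite_poset_prod[OF finite_poset_octagon finite_poset_strata[OF om]]])
  note se = oriented_matroid_se[OF om]
  show "(coord (fst p) e, snd p) \<in> octagon \<times> strata F {e}" if "p \<in> twisted F e" for p
    using that e by (auto simp: twisted_def strata_iff)
  show "prod_le oct_le strata_le (coord (fst p) e, snd p) (coord (fst q) e, snd q)" if "twisted_le p q" for p q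
    using that by (simp add: prod_le_def[of strata_le] strata_le_iff)
  fix q assume q: "q \<in> octagon \<times> strata F {e}"
  obtain l w0 where lw: "q = (l, w0)" by (cases q)
  have lo: "l \<in> octagon" and w0: "w0 \<in> strata F {e}" using q by (auto simp: lw)
  define S where "S = {p \<in> twisted F e. oct_le (coord (fst p) e) l \<and> strata_le (snd p) w0}"
  have S: "{p \<in> twisted F e. prod_le oct_le strata_le (coord (fst p) e, snd p) q} = S" by (auto simp: S_def lw)
  have pS: "finite_poset twisted_le S" by (rule finite_poset_subset[OF finite_poset_twisted[OF om]]) (auto simp: S_def)
  have w0F: "fst w0 \<in> F" "snd w0 \<in> F" using w0 by (auto simp: strata_iff)
  have refl: "strata_le z z" for z :: "('a \<Rightarrow> sign) \<times> ('a \<Rightarrow> sign)" by (simp add: prod_le_def sv_le_iff)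
  have reflo: "oct_le k k" for k by (simp add: prod_le_def)
  define z0 where "z0 = rotv l w0"
  have w0e: "coord w0 e = (Zero, Pos)" using w0 by (simp add: strata_iff)
  have z0e: "coord z0 e = l" by (simp add: z0_def w0e rot_unit)
  have z0o: "coord z0 f \<in> octagon" if "f \<in> nonloops F" for f
    using w0 that lo by (simp add: z0_def rot_octagon strata_iff)
  show "contr_poset twisted_le {p \<in> twisted F e. prod_le oct_le strata_le (coord (fst p) e, snd p) q}"
    unfolding S
  proof (cases "axial l")
    case True
    have z0: "z0 \<in> strata F {}"
      using z0o rotv_axial_mem[OF om w0F True lo] by (simp add: strata_iff z0_def)
    have "(z0, w0) \<in> S" using z0 w0 refl reflo by (simp add: S_def twisted_def z0e) (simp add: z0_def near_rot_rot True lo)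
    moreover have "twisted_le p (z0, w0)" if p: "p \<in> S" for p
    proof -
      obtain z w where zw: "p = (z, w)" by (cases p)
      have z: "z \<in> strata F {}" "oct_le (coord z e) l" "strata_le w w0" "\<And>f. near_rot (coord z e) (coord w f) (coord z f)"
        using p by (auto simp: S_def twisted_def zw)
      have "coord z e = l"
        using z e True by (intro oct_le_axial) (auto simp: strata_iff)
      then have "coord z f = rot l (coord w f)" for f using z(4)[of f] True by (simp add: near_rot_def)
      then have "strata_le z z0"
        using z(3) True lo by (simp add: strata_le_iff z0_def rot_axial_mono)
      then show ?thesis using z(3) by (simp add: zw)
    qed
    ultimately show "contr_poset twisted_le S" by (intro contr_poset_cone[OF pS]) auto
  next
    case False
    define KX where "KX = {X \<in> F. sv_le (fst z0) X}"
    define KY where "KY = {Y \<in> F. sv_le (snd z0) Y}"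
    have seX: "se_family E KX" unfolding KX_def by (intro se_family_above se)
    have seY: "se_family E KY" unfolding KY_def by (intro se_family_above se)
    have ne: "KX \<noteq> {}" "KY \<noteq> {}"
      using rotv_upper_bounds[OF om w0F False] by (auto simp: KX_def KY_def z0_def)
    have mem: "(z, w0) \<in> S" if z: "z \<in> KX \<times> KY" for z
    proof -
      have zF: "fst z \<in> F" "snd z \<in> F" "strata_le z0 z"
        using z by (auto simp: KX_def KY_def prod_le_def)
      then have le: "oct_le (coord z0 f) (coord z f)" for f by (simp add: strata_le_iff)
      \<comment> \<open>An open direction has no zero coordinate left to enlarge, so passing above
        \<open>z0\<close> does not change the value at \<open>e\<close>.\<close>
      have ze: "coord z e = l" using le[of e] False unfolding z0e by (cases l) (simp add: coord_def sg_le_def)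
      have "coord z f \<in> octagon" if "f \<in> nonloops F" for f
        using le[of f] z0o[OF that] by (auto simp: octagon_def coord_def sg_le_def)
      then have zs: "z \<in> strata F {}" using zF by (simp add: strata_iff)
      moreover have "near_rot l (coord w0 f) (coord z f)" for f
      proof (cases "f \<in> nonloops F")
        case True
        then show ?thesis using w0 le[of f] by (intro near_rot_above[OF False]) (auto simp: strata_iff z0_def)
      next
        case f: False
        then show ?thesis using strata_off[OF w0 f] strata_off[OF zs f] by simp
      qed
      ultimately show ?thesis using w0 refl reflo by (simp add: S_def twisted_def ze)
    qed
    show "contr_poset twisted_le S"
    proof (rule contr_poset_cofinal[OF pS])
      show "(KX \<times> KY) \<times> {w0} \<subseteq> S" using mem by auto
      show "contr_poset twisted_le ((KX \<times> KY) \<times> {w0})"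
        by (rule contr_poset_pair_left[where le'=strata_le, OF contr_poset_Times_se[OF seX ne(1) seY ne(2)] refl])
      fix p assume p: "p \<in> S"
      obtain z w where zw: "p = (z, w)" by (cases p)
      have z: "z \<in> strata F {}" "oct_le (coord z e) l" "strata_le w w0" "w \<in> strata F {e}" "\<And>f. near_rot (coord z e) (coord w f) (coord z f)"
        using p by (auto simp: S_def twisted_def zw)
      have cp: "pair_compat (coord z f) (coord z0 f)" for f
      proof (cases "f \<in> nonloops F")
        case True
        have "oct_le (coord w f) (coord w0 f)" using z(3) by (simp add: strata_le_iff)
        moreover have "coord z e \<in> octagon" "coord w f \<in> octagon" using z(1,4) e True by (simp_all add: strata_iff)
        ultimately show ?thesis unfolding z0_def coord_rotv using near_rot_compat[OF z(5) z(2)] False by blast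
      next
        case f: False
        then show ?thesis using strata_off[OF z(1) f] by (cases "coord z0 f") (simp add: sign_compat_def)
      qed
      define KX' where "KX' = {U \<in> KX. sv_le (fst z) U}"
      define KY' where "KY' = {V \<in> KY. sv_le (snd z) V}"
      have zF: "fst z \<in> F" "snd z \<in> F" using z(1) by (auto simp: strata_iff)
      obtain X0 Y0 where XY: "X0 \<in> KX" "Y0 \<in> KY" using ne by blast
      have "sv_comp (fst z) X0 \<in> KX'"
      proof -
        have "sv_le (fst z0) (sv_comp (fst z) X0)"
          using XY(1) cp by (intro sv_le_comp_compat) (auto simp: KX_def coord_def)
        moreover have "sv_comp (fst z) X0 \<in> F" using XY(1) zF se_family_comp[OF se] by (simp add: KX_def)
        ultimately show ?thesis by (simp add: KX'_def KX_def sv_comp_le)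
      qed
      moreover have "sv_comp (snd z) Y0 \<in> KY'"
      proof -
        have "sv_le (snd z0) (sv_comp (snd z) Y0)"
          using XY(2) cp by (intro sv_le_comp_compat) (auto simp: KY_def coord_def)
        moreover have "sv_comp (snd z) Y0 \<in> F" using XY(2) zF se_family_comp[OF se] by (simp add: KY_def)
        ultimately show ?thesis by (simp add: KY'_def KY_def sv_comp_le)
      qed
      ultimately have ne': "KX' \<noteq> {}" "KY' \<noteq> {}" by blast+
      have "{y \<in> (KX \<times> KY) \<times> {w0}. twisted_le p y} = (KX' \<times> KY') \<times> {w0}"
        using z(3) by (auto simp: zw KX'_def KY'_def prod_le_def)
      moreover have "contr_poset twisted_le ((KX' \<times> KY') \<times> {w0})"
        by (rule contr_poset_pair_left[where le'=strata_le, OF contr_poset_Times_se[OF _ ne'(1) _ ne'(2)] refl])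
           (unfold KX'_def KY'_def, (rule se_family_above[OF seX] se_family_above[OF seY])+)
      ultimately show "contr_poset twisted_le {y \<in> (KX \<times> KY) \<times> {w0}. twisted_le p y}" by simp
    qed
  qed
qed

section \<open>Assembling the equivalences\<close>

lemma homotopy_equivalent_space_prod:
  assumes "X homotopy_equivalent_space X'" "Y homotopy_equivalent_space Y'"
  shows "prod_topology X Y homotopy_equivalent_space prod_topology X' Y'"
proof -
  obtain f f' where f: "continuous_map X X' f" "continuous_map X' X f'"
      "homotopic_with (\<lambda>_. True) X X (f' \<circ> f) id" "homotopic_with (\<lambda>_. True) X' X' (f \<circ> f') id"
    using assms(1) by (auto simp: homotopy_equivalent_space_def)
  obtain g g' where g: "continuous_map Y Y' g" "continuous_map Y' Y g'"
      "homotopic_with (\<lambda>_. True) Y Y (g' \<circ> g) id" "homotopic_with (\<lambda>_. True) Y' Y' (g \<circ> g') id"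
    using assms(2) by (auto simp: homotopy_equivalent_space_def)
  define h where "h = (\<lambda>(x, y). (f x, g y))"
  define h' where "h' = (\<lambda>(x, y). (f' x, g' y))"
  have "homotopic_with (\<lambda>_. True) (prod_topology X Y) (prod_topology X Y) (h' \<circ> h) id"
    using homotopic_with_prod_topology[OF f(3) g(3)]
    by (auto simp: h_def h'_def o_def case_prod_unfold id_def)
  moreover have "homotopic_with (\<lambda>_. True) (prod_topology X' Y') (prod_topology X' Y') (h \<circ> h') id"
    using homotopic_with_prod_topology[OF f(4) g(4)]
    by (auto simp: h_def h'_def o_def case_prod_unfold id_def)
  moreover have "continuous_map (prod_topology X Y) (prod_topology X' Y') h"
    using f g unfolding h_def by (simp add: continuous_map_prod_top)
  moreover have "continuous_map (prod_topology X' Y') (prod_topology X Y) h'"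
    using f g unfolding h'_def by (simp add: continuous_map_prod_top)
  ultimately show ?thesis unfolding homotopy_equivalent_space_def by blast
qed

theorem theorem4p9:
  fixes E :: "'e set" and F :: "('e \<Rightarrow> sign) set" and e :: 'e
  assumes "oriented_matroid E F"
    and "e \<in> E"
    and "\<exists>X\<in>F. X e \<noteq> Zero"
  shows "order_realization (salvetti F) salvetti_le homotopy_equivalent_space
           prod_topology circle (order_realization (deconed_salvetti F e) salvetti_le)"
proof -
  note om = assms(1)
  have e: "e \<in> nonloops F" using assms(3) by (simp add: nonloops_def)
  define D where "D = deconed_salvetti F e"
  \<comment> \<open>For a Salvetti pair the tope inherits the sign of the covector, so requiring
    \<open>Pos\<close> at \<open>e\<close> of the covector alone already gives the deconed
    poset.\<close>
  have D: "{(Y, C) \<in> salvetti F. \<forall>f\<in>{e}. Y f = Pos} = D"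
  proof -
    have "C e = Pos" if "(Y, C) \<in> salvetti F" "Y e = Pos" for Y C
    proof -
      have "sv_comp Y C = C" using that(1) by (simp add: salvetti_def)
      from fun_cong[OF this, of e] show ?thesis using that(2) by (simp add: sv_comp_def)
    qed
    then show ?thesis by (auto simp: D_def deconed_salvetti_def decone_def salvetti_def topes_def)
  qed
  have fin: "finite (salvetti F)" "finite D"
    using finite_salvetti[OF om] by (auto simp: D_def deconed_salvetti_def intro: finite_subset[rotated])
  have R: "top_of_set (order_complex salvetti_le A) homotopy_equivalent_space order_realization A salvetti_le" if "finite A" for A :: "(('e \<Rightarrow> sign) \<times> ('e \<Rightarrow> sign)) set"
    using homeomorphic_imp_homotopy_equivalent_space[OF order_realization_homeomorphic[OF that]]
    by (subst homotopy_equivalent_space_sym)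
  have 1: "order_realization (salvetti F) salvetti_le homotopy_equivalent_space top_of_set (order_complex salvetti_le (salvetti F))"
    by (rule homeomorphic_imp_homotopy_equivalent_space[OF order_realization_homeomorphic[OF fin(1)]])
  have 2: "order_complex salvetti_le (salvetti F) homotopy_eqv order_complex strata_le (strata F {})"
    using strata_salvetti[OF om, of "{}" e] by (subst homotopy_equivalent_space_sym) simp
  have 3: "order_complex strata_le (strata F {}) homotopy_eqv order_complex twisted_le (twisted F e)"
    using twisted_strata[OF om e] by (subst homotopy_equivalent_space_sym)
  note 4 = twisted_octagon[OF om e]
  have 5: "order_complex (prod_le oct_le strata_le) (octagon \<times> strata F {e}) homotopy_eqv order_complex oct_le octagon \<times> order_complex strata_le (strata F {e})"
    by (rule homeomorphic_imp_homotopy_eqv[OF order_complex_prod_homeomorphic[OF finite_poset_octagon finite_poset_strata[OF om]]])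
  have "top_of_set (order_complex oct_le octagon) homotopy_equivalent_space circle"
    unfolding circle_def by (rule homeomorphic_imp_homotopy_eqv[OF octagon_circle])
  moreover have "top_of_set (order_complex strata_le (strata F {e})) homotopy_equivalent_space order_realization D salvetti_le"
    using homotopy_eqv_trans[OF strata_salvetti[OF om, of "{e}" e, unfolded D] R[OF fin(2)]] by simp
  ultimately have 6: "top_of_set (order_complex oct_le octagon \<times> order_complex strata_le (strata F {e})) homotopy_equivalent_space prod_topology circle (order_realization D salvetti_le)"
    unfolding prod_topology_subtopology_eu[symmetric] by (rule homotopy_equivalent_space_prod)
  show ?thesis
    unfolding D_def[symmetric]
    by (rule homotopy_eqv_trans[OF 1 homotopy_eqv_trans[OF 2 homotopy_eqv_trans[OF 3
          homotopy_eqv_trans[OF 4 homotopy_eqv_trans[OF 5 6]]]]])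
qed

end
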